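(* When $d \geq 3$, any $d\times d\times d$ tensor $T$ satisfies \[ \underset{\sim}{\mathrm{R}}(T) \leq \sqrt{d^{\frac 4 3 \omega} + d^{\frac{2}{3}\omega} - (d^3-d^2)^{\frac{\omega}{3}}} < d^{\frac 2 3 \omega}. \]
   Context: $\omega$ is the matrix multiplication exponent. $\mathrm{R}(T)$ is tensor rank and $\underset{\sim}{\mathrm{R}}(T) = \lim_{n\to\infty}\mathrm{R}(T^{\otimes n})^{1/n}$ is asymptotic rank. The proof starts from the restriction $T^{\otimes 2}\le\langle d,d^2,d\rangle$, where $\langle n,m,p\rangle$ is the matrix multiplication tensor. *)

theory Defs
  imports Complex_Main "HOL-Library.FuncSet" "HOL-Library.Landau_Symbols"
begin

text \<open>
  An order-three tensor in $F^I \otimes F^J \otimes F^K$ is given by its coordinate array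
  \<open>T i j k\<close>; the (finite) index sets \<open>I\<close>, \<open>J\<close>, \<open>K\<close> are passed separately,
  and entries of the array outside \<open>I \<times> J \<times> K\<close> are ignored. A $d \times d \times d$ tensor has
  \<open>I = J = K = {..<d}\<close>.
\<close>

type_synonym ('i, 'j, 'k, 'a) tensor = "'i \<Rightarrow> 'j \<Rightarrow> 'k \<Rightarrow> 'a"

definition rank_decomposition ::
    "'i set \<Rightarrow> 'j set \<Rightarrow> 'k set \<Rightarrow> ('i, 'j, 'k, 'a::field) tensor \<Rightarrow> nat \<Rightarrow> bool" where
  "rank_decomposition I J K T r \<longleftrightarrow>
     (\<exists>(u :: nat \<Rightarrow> 'i \<Rightarrow> 'a) (v :: nat \<Rightarrow> 'j \<Rightarrow> 'a) (w :: nat \<Rightarrow> 'k \<Rightarrow> 'a).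
        \<forall>i\<in>I. \<forall>j\<in>J. \<forall>k\<in>K. T i j k = (\<Sum>s<r. u s i * v s j * w s k))"

text \<open>For finite index sets some decomposition always exists, so the minimum is attained.\<close>

definition tensor_rank ::
    "'i set \<Rightarrow> 'j set \<Rightarrow> 'k set \<Rightarrow> ('i, 'j, 'k, 'a::field) tensor \<Rightarrow> nat" where
  "tensor_rank I J K T = (LEAST r. rank_decomposition I J K T r)"

text \<open>
  The $n$-th Kronecker power. If \<open>T\<close> has index sets \<open>I\<close>, \<open>J\<close>, \<open>K\<close>, the power has the
  index sets of $n$-tuples \<open>{..<n} \<rightarrow>\<^sub>E I\<close>, \<open>{..<n} \<rightarrow>\<^sub>E J\<close>, \<open>{..<n} \<rightarrow>\<^sub>E K\<close>.
\<close>

definition tensor_power ::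
    "('i, 'j, 'k, 'a::field) tensor \<Rightarrow> nat \<Rightarrow>
     (nat \<Rightarrow> 'i, nat \<Rightarrow> 'j, nat \<Rightarrow> 'k, 'a) tensor" where
  "tensor_power T n = (\<lambda>f g h. \<Prod>t<n. T (f t) (g t) (h t))"

text \<open>
  The limit exists for finite index sets: the rank is submultiplicative under Kronecker
  products, so Fekete's lemma applies.
\<close>

definition asymptotic_rank ::
    "'i set \<Rightarrow> 'j set \<Rightarrow> 'k set \<Rightarrow> ('i, 'j, 'k, 'a::field) tensor \<Rightarrow> real" where
  "asymptotic_rank I J K T =
     lim (\<lambda>n. root n (real (tensor_rank ({..<n} \<rightarrow>\<^sub>E I) ({..<n} \<rightarrow>\<^sub>E J) ({..<n} \<rightarrow>\<^sub>E K)
                              (tensor_power T n))))"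

text \<open>
  The matrix multiplication tensor $\langle n,m,p \rangle = \sum_{i<n,\, j<m,\, k<p} e_{ij} \otimes e_{jk} \otimes e_{ki}$
  is this array on the index sets \<open>{..<n} \<times> {..<m}\<close>, \<open>{..<m} \<times> {..<p}\<close>, \<open>{..<p} \<times> {..<n}\<close>.
\<close>

definition matmul_tensor :: "(nat \<times> nat, nat \<times> nat, nat \<times> nat, 'a::field) tensor" where
  "matmul_tensor = (\<lambda>(i, j) (j', k) (k', i'). if i = i' \<and> j = j' \<and> k = k' then 1 else 0)"

definition matmul_rank :: "'a::field itself \<Rightarrow> nat \<Rightarrow> nat \<Rightarrow> nat \<Rightarrow> nat" where
  "matmul_rank _ n m p =
     tensor_rank ({..<n} \<times> {..<m}) ({..<m} \<times> {..<p}) ({..<p} \<times> {..<n})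
       (matmul_tensor :: (nat \<times> nat, nat \<times> nat, nat \<times> nat, 'a) tensor)"

text \<open>The matrix multiplication exponent depends on the ground field \<open>'a\<close> only.\<close>

definition matmul_exponent :: "'a::field itself \<Rightarrow> real" where
  "matmul_exponent F =
     Inf {\<tau>. (\<lambda>n. real (matmul_rank F n n n)) \<in> O(\<lambda>n. real n powr \<tau>)}"

end

theory Submission
  imports Defs "HOL-Computational_Algebra.Polynomial" "HOL-Library.Function_Algebras"
begin

text \<open>
  Contracting each factor with its variables in one direction, \<open>T \<otimes> T\<close> is the trace of a product of matrices of sizes
  \<open>d \<times> d\<^sup>2\<close>, \<open>d\<^sup>2 \<times> d\<close>, \<open>d \<times> d\<close>, the first two of which only range over spaces of dimension \<open>d\<^sup>2\<close>
  inside spaces of dimension \<open>d\<^sup>3\<close>. As in Schoenhage's example, the unused \<open>d\<^sup>3 - d\<^sup>2\<close> dimensions carry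
  an additional inner product: \<open>T \<otimes> T \<oplus> \<langle>1, d\<^sup>3 - d\<^sup>2, 1\<rangle>\<close> is a degeneration of
  \<open>\<langle>d, d\<^sup>2, d\<rangle> \<oplus> \<langle>1, d\<^sup>2, 1\<rangle>\<close>.

  To subtract the extra summand one needs a monotone functional \<open>G\<close> on tensors that is additive on this
  direct sum and has \<open>G T\<close> equal to the asymptotic rank \<open>F T\<close>. Instead of a point of Strassen's asymptotic
  spectrum it suffices to smoothen \<open>F\<close> finitely often, passing from \<open>F\<close> to
  \<open>x \<mapsto> lim F (f\<^sup>n x) / F f\<^sup>n\<close>, which makes the functional multiplicative at \<open>f\<close>; superadditivity follows
  from the binomial theorem. With \<open>f\<close> running through \<open>T\<close>, \<open>\<langle>d, 1, 1\<rangle>\<close> and \<open>\<langle>1, d, 1\<rangle>\<close> the exponents of \<open>G\<close> in the three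
  directions add up to at most \<open>\<omega>\<close>, so one of them is at most \<open>\<omega> / 3\<close>, and rotating the tensors
  makes it the direction of the extra inner product.
\<close>

section \<open>Asymptotic growth of submultiplicative sequences\<close>

text \<open>The asymptotic rank \<open>F\<close> is subadditive and submultiplicative, so from an
  asymptotic inequality between direct sums nothing can be subtracted: this obstacle forces the
  change of functional. The proof of superadditivity evaluates single binomial terms exactly.
  Besides multiplicativity at one summand it therefore uses
  \<open>G (of_nat m * x) = m * G x\<close>, which must already hold for \<open>F\<close>, where it
  rests on cancelling copies of a tensor. Multiplicativity in two of the three directions is enough,
  since it splits \<open>G\<close> at \<open>MM d d d\<close> into three factors. With n = d^3 - d^2
  and an exponent b <= \<omega>/3 in the chosen direction, the estimate reads G(T)^2 <= d^(\<omega>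
  + b) + d^(2 b) - n^b. As b may lie well below \<omega>/3, the right side still has to be shown to
  increase in b. This, and n > d^2 for the strict inequality, is where d >= 3 enters.\<close>

lemma tendsto_root_polynomial:
  fixes C :: real
  assumes "C > 0"
  shows "(\<lambda>n. root n (C * real (n + 1) ^ k)) \<longlonglongrightarrow> 1"
proof -
  have "(\<lambda>n. root n (real (n + 1))) \<longlonglongrightarrow> 1"
  proof (rule tendsto_sandwich)
    show "\<forall>\<^sub>F n in sequentially. 1 \<le> root n (real (n + 1))"
      using eventually_gt_at_top[of 0] by eventually_elim (simp add: real_root_ge_1_iff)
    show "\<forall>\<^sub>F n in sequentially. root n (real (n + 1)) \<le> root n 2 * root n (real n)"
      using eventually_gt_at_top[of 0]
    proof eventually_elim
      case (elim n)
      then have "root n (real (n + 1)) \<le> root n (2 * real n)"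
        by (intro real_root_le_mono) auto
      then show ?case by (simp add: real_root_mult)
    qed
    have "(\<lambda>n. root n 2 * root n (real n)) \<longlonglongrightarrow> 1 * 1"
      by (intro tendsto_mult LIMSEQ_root LIMSEQ_root_const) simp
    then show "(\<lambda>n. root n 2 * root n (real n)) \<longlonglongrightarrow> 1" by simp
  qed simp
  then have "(\<lambda>n. root n C * root n (real (n + 1)) ^ k) \<longlonglongrightarrow> 1 * 1 ^ k"
    by (intro tendsto_mult tendsto_power LIMSEQ_root_const assms)
  moreover have "\<forall>\<^sub>F n in sequentially. root n C * root n (real (n + 1)) ^ k = root n (C * real (n + 1) ^ k)"
    using eventually_gt_at_top[of 0]
    by eventually_elim (simp add: real_root_mult real_root_power)
  ultimately show ?thesis by (simp add: tendsto_cong)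
qed

text \<open>Polynomial factors vanish under the n-th root. This absorbs both the number of terms of
  a binomial expansion and the loss in passing from a degeneration to a rank bound.\<close>

lemma root_limit_le:
  fixes u :: "nat \<Rightarrow> real"
  assumes lim: "(\<lambda>n. root n (u n)) \<longlonglongrightarrow> L" and "\<rho> \<ge> 0"
    and u: "\<And>n. u n \<le> C * real (n + 1) ^ k * \<rho> ^ n"
  shows "L \<le> \<rho>"
proof -
  define D where "D = max C 1"
  have D: "D > 0" "C \<le> D" by (auto simp: D_def)
  have "(\<lambda>n. root n (D * real (n + 1) ^ k) * \<rho>) \<longlonglongrightarrow> 1 * \<rho>"
    by (intro tendsto_mult tendsto_root_polynomial D tendsto_const)
  moreover have "\<forall>\<^sub>F n in sequentially. root n (u n) \<le> root n (D * real (n + 1) ^ k) * \<rho>"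
    using eventually_gt_at_top[of 0]
  proof eventually_elim
    case (elim n)
    have "u n \<le> D * real (n + 1) ^ k * \<rho> ^ n"
      using u[of n] D \<open>\<rho> \<ge> 0\<close> by (meson mult_right_mono order_trans zero_le_power of_nat_0_le_iff)
    then have "root n (u n) \<le> root n (D * real (n + 1) ^ k * \<rho> ^ n)"
      using elim by (intro real_root_le_mono)
    also have "\<dots> = root n (D * real (n + 1) ^ k) * \<rho>"
      using elim \<open>\<rho> \<ge> 0\<close> by (simp add: real_root_mult real_root_power_cancel)
    finally show ?case .
  qed
  ultimately show ?thesis
    using lim by (intro tendsto_le[OF sequentially_bot]) auto
qed

lemma le_of_power_le:
  fixes x y :: real
  assumes "x \<ge> 0" "y \<ge> 0" "\<And>n. x ^ n \<le> C * real (n + 1) ^ k * y ^ n"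
  shows "x \<le> y"
proof (rule root_limit_le[where u = "\<lambda>n. x ^ n"])
  have "\<forall>\<^sub>F n in sequentially. root n (x ^ n) = x"
    using eventually_gt_at_top[of 0] by eventually_elim (simp add: real_root_power_cancel assms)
  then show "(\<lambda>n. root n (x ^ n)) \<longlonglongrightarrow> x" by (simp add: tendsto_cong)
qed (use assms in auto)

lemma submultiplicative_bound:
  fixes u :: "nat \<Rightarrow> real"
  assumes u0: "\<And>n. u n \<ge> 0" and sub: "\<And>m n. u (m + n) \<le> u m * u n"
    and m: "m > 0" "u m \<le> \<rho> ^ m" and \<rho>: "\<rho> > 0"
  shows "\<exists>C>0. \<forall>n. u n \<le> C * \<rho> ^ n"
proof -
  have iter: "u (q * m + r) \<le> u m ^ q * u r" for q r
  proof (induction q)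
    case (Suc q)
    have "u (Suc q * m + r) \<le> u m * u (q * m + r)" using sub[of m "q * m + r"] by (simp add: ac_simps)
    also have "\<dots> \<le> u m * (u m ^ q * u r)" by (intro mult_left_mono Suc u0)
    finally show ?case by (simp add: ac_simps)
  qed simp
  \<comment> \<open>The sum absorbs the remainders r < m of the division by m; the extra 1 keeps the
    constant positive even if every \<open>u r\<close> vanishes.\<close>
  define C where "C = 1 + (\<Sum>r<m. u r / \<rho> ^ r)"
  have C: "C > 0" unfolding C_def using u0 \<rho> by (intro add_pos_nonneg sum_nonneg) auto
  have "u n \<le> C * \<rho> ^ n" for n
  proof -
    define q r where "q = n div m" and "r = n mod m"
    have n: "n = q * m + r" "r < m" using m by (auto simp: q_def r_def)
    have "u r / \<rho> ^ r \<le> (\<Sum>r<m. u r / \<rho> ^ r)"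
      using n(2) u0 \<rho> by (intro member_le_sum) auto
    then have "u r / \<rho> ^ r \<le> C" by (simp add: C_def)
    then have "u r \<le> C * \<rho> ^ r" using \<rho> by (simp add: pos_divide_le_eq)
    moreover have "u m ^ q \<le> (\<rho> ^ m) ^ q" by (intro power_mono m u0)
    ultimately have "u m ^ q * u r \<le> (\<rho> ^ m) ^ q * (C * \<rho> ^ r)"
      using u0 \<rho> by (intro mult_mono) auto
    then show ?thesis using iter[of q r] n
      by (simp add: power_add power_mult ac_simps)
  qed
  then show ?thesis using C by blast
qed

text \<open>Fekete's lemma: the limit is the infimum of the roots. The upper estimate starts
  \<open>submultiplicative_bound\<close> at an index whose root is already close to the
  infimum.\<close>

lemma fekete_root:
  fixes u :: "nat \<Rightarrow> real"
  assumes u0: "\<And>n. u n \<ge> 0" and sub: "\<And>m n. u (m + n) \<le> u m * u n"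
  shows "convergent (\<lambda>n. root n (u n))"
proof -
  define S where "S = (\<lambda>n. root n (u n)) ` {1..}"
  have S: "S \<noteq> {}" "bdd_below S"
    using u0 by (auto simp: S_def intro!: bdd_belowI[of _ 0])
  have lower: "Inf S \<le> root n (u n)" if "n > 0" for n
    using that S by (intro cInf_lower) (auto simp: S_def)
  have "Inf S \<ge> 0" using S u0 by (intro cInf_greatest) (auto simp: S_def)
  have "(\<lambda>n. root n (u n)) \<longlonglongrightarrow> Inf S"
  proof (rule order_tendstoI)
    fix a assume "a < Inf S"
    show "\<forall>\<^sub>F n in sequentially. a < root n (u n)"
      using eventually_gt_at_top[of 0]
    proof eventually_elim
      case (elim n)
      then show ?case using lower[of n] \<open>a < Inf S\<close> by linarith
    qed
  next
    fix a assume "Inf S < a"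
    then obtain \<rho> where \<rho>: "Inf S < \<rho>" "\<rho> < a" using dense[of "Inf S" a] by blast
    obtain s where "s \<in> S" "s < \<rho>" using cInf_lessD[OF S(1) \<rho>(1)] by blast
    then obtain m where m: "m > 0" "root m (u m) < \<rho>"
      unfolding S_def by (auto simp: Suc_le_eq)
    have "\<rho> > 0" using \<open>Inf S \<ge> 0\<close> \<rho> by simp
    have "u m = root m (u m) ^ m" using m u0 by simp
    also have "\<dots> \<le> \<rho> ^ m" using m u0 by (intro power_mono) auto
    finally obtain C where C: "C > 0" "\<And>n. u n \<le> C * \<rho> ^ n"
      using submultiplicative_bound[of u m \<rho>] u0 sub m \<open>\<rho> > 0\<close> by blast
    have "(\<lambda>n. root n C * \<rho>) \<longlonglongrightarrow> 1 * \<rho>"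
      by (intro tendsto_mult LIMSEQ_root_const C tendsto_const)
    then have "\<forall>\<^sub>F n in sequentially. root n C * \<rho> < a"
      using \<rho> by (intro order_tendstoD) auto
    then show "\<forall>\<^sub>F n in sequentially. root n (u n) < a"
      using eventually_gt_at_top[of 0]
    proof eventually_elim
      case (elim n)
      have "root n (u n) \<le> root n (C * \<rho> ^ n)"
        using elim C by (intro real_root_le_mono) auto
      also have "\<dots> = root n C * \<rho>"
        using elim \<open>\<rho> > 0\<close> by (simp add: real_root_mult real_root_power_cancel)
      finally show ?case using elim by simp
    qed
  qed
  then show ?thesis by (rule convergentI)
qed

section \<open>Semirings with a rank function\<close>

text \<open>In the application \<open>of_nat r\<close> is the unit tensor of size r. The last axiom
  abstracts that an element of rank r is a restriction of this tensor and that restrictions survive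
  multiplication. It implies submultiplicativity of \<open>R\<close> and is what later allows copies
  to be cancelled.\<close>

locale rank_semiring =
  fixes R :: "'b::comm_semiring_1 \<Rightarrow> nat"
  assumes R_add: "R (x + y) \<le> R x + R y"
    and R_le_add: "R x \<le> R (x + y)"
    and R_of_nat: "R (of_nat n) = n"
    and R_mult_of_nat: "R (x * y) \<le> R (of_nat (R x) * y)"
begin

lemma R_scale: "R (of_nat n * x) \<le> n * R x"
proof (induction n)
  case 0
  show ?case using R_of_nat[of 0] by simp
next
  case (Suc n)
  have "R (of_nat (Suc n) * x) \<le> R x + R (of_nat n * x)"
    using R_add[of x "of_nat n * x"] by (simp add: distrib_right)
  then show ?case using Suc by simp
qed

lemma R_mult: "R (x * y) \<le> R x * R y"
  using R_mult_of_nat[of x y] R_scale[of "R x" y] by linarith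

lemma R_1: "R 1 = 1"
  using R_of_nat[of 1] by simp

lemma R_mono_scale:
  assumes "m \<le> n"
  shows "R (of_nat m * x) \<le> R (of_nat n * x)"
proof -
  have "of_nat n * x = of_nat m * x + of_nat (n - m) * x"
    using assms by (simp flip: distrib_right of_nat_add)
  then show ?thesis using R_le_add by metis
qed

section \<open>Asymptotic rank in a rank semiring\<close>

definition F :: "'b \<Rightarrow> real" where
  "F x = lim (\<lambda>n. root n (real (R (x ^ n))))"

lemma F_tendsto: "(\<lambda>n. root n (real (R (x ^ n)))) \<longlonglongrightarrow> F x"
proof -
  have "convergent (\<lambda>n. root n (real (R (x ^ n))))"
  proof (rule fekete_root)
    fix m n
    show "real (R (x ^ (m + n))) \<le> real (R (x ^ m)) * real (R (x ^ n))"
      using R_mult[of "x ^ m" "x ^ n"] by (simp add: power_add flip: of_nat_mult)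
  qed simp
  then show ?thesis by (simp add: F_def convergent_LIMSEQ_iff)
qed

lemma F_nonneg: "F x \<ge> 0"
  using F_tendsto by (rule LIMSEQ_le_const) (auto intro!: exI[of _ 1])

lemma F_leI:
  assumes "\<rho> \<ge> 0" "\<And>n. real (R (x ^ n)) \<le> C * real (n + 1) ^ k * \<rho> ^ n"
  shows "F x \<le> \<rho>"
  using root_limit_le[OF F_tendsto assms] .

lemma R_power: "R (x ^ n) \<le> R x ^ n"
proof (induction n)
  case (Suc n)
  have "R (x ^ Suc n) \<le> R x * R (x ^ n)" using R_mult[of x "x ^ n"] by simp
  also have "\<dots> \<le> R x * R x ^ n" by (intro mult_le_mono2 Suc)
  finally show ?case by simp
qed (simp add: R_1)

lemma F_le_R: "F x \<le> real (R x)"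
proof (rule F_leI)
  fix n
  have "real (R (x ^ n)) \<le> real (R x ^ n)" using R_power by (simp only: of_nat_le_iff)
  then show "real (R (x ^ n)) \<le> 1 * real (n + 1) ^ 0 * real (R x) ^ n" by simp
qed simp

text \<open>Slack above the limit turns the asymptotics of roots into an exponential bound for every
  n, the form that can be inserted termwise into binomial expansions.\<close>

lemma F_bound:
  assumes "F x < \<rho>"
  shows "\<exists>C>0. \<forall>n. real (R (x ^ n)) \<le> C * \<rho> ^ n"
proof -
  have "\<forall>\<^sub>F n in sequentially. root n (real (R (x ^ n))) < \<rho> \<and> n > 0"
    using order_tendstoD(2)[OF F_tendsto assms] eventually_gt_at_top[of 0]
    by (rule eventually_conj)
  then obtain m where m: "m > 0" "root m (real (R (x ^ m))) < \<rho>"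
    by (auto simp: eventually_sequentially)
  have "real (R (x ^ m)) = root m (real (R (x ^ m))) ^ m" using m by simp
  also have "\<dots> \<le> \<rho> ^ m" using m by (intro power_mono) auto
  finally have *: "real (R (x ^ m)) \<le> \<rho> ^ m" .
  have sub: "real (R (x ^ (m + n))) \<le> real (R (x ^ m)) * real (R (x ^ n))" for m n
    using R_mult[of "x ^ m" "x ^ n"] by (simp add: power_add flip: of_nat_mult)
  show ?thesis
    using submultiplicative_bound[of "\<lambda>n. real (R (x ^ n))" m \<rho>] m * sub F_nonneg[of x] assms
    by auto
qed

lemma F_mono_asymp:
  assumes "\<And>n. real (R (x ^ n)) \<le> C * real (n + 1) ^ k * real (R (y ^ n))" "C \<ge> 0"
  shows "F x \<le> F y"
proof (rule dense_ge)
  fix \<rho> assume "F y < \<rho>"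
  then obtain D where D: "D > 0" "\<And>n. real (R (y ^ n)) \<le> D * \<rho> ^ n" using F_bound by blast
  show "F x \<le> \<rho>"
  proof (rule F_leI)
    show "\<rho> \<ge> 0" using F_nonneg[of y] \<open>F y < \<rho>\<close> by simp
    fix n
    have "C * real (n + 1) ^ k * real (R (y ^ n)) \<le> C * real (n + 1) ^ k * (D * \<rho> ^ n)"
      using assms D by (intro mult_left_mono) auto
    then show "real (R (x ^ n)) \<le> (C * D) * real (n + 1) ^ k * \<rho> ^ n"
      using assms(1)[of n] by (simp add: ac_simps)
  qed
qed

lemma F_mult: "F (x * y) \<le> F x * F y"
proof (rule tendsto_le[OF sequentially_bot tendsto_mult[OF F_tendsto F_tendsto] F_tendsto])
  show "\<forall>\<^sub>F n in sequentially. root n (real (R ((x * y) ^ n))) \<le>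
      root n (real (R (x ^ n))) * root n (real (R (y ^ n)))"
    using eventually_gt_at_top[of 0]
  proof eventually_elim
    case (elim n)
    have "real (R ((x * y) ^ n)) \<le> real (R (x ^ n)) * real (R (y ^ n))"
      using R_mult[of "x ^ n" "y ^ n"] by (simp add: power_mult_distrib flip: of_nat_mult)
    then show ?case using elim by (simp flip: real_root_mult)
  qed
qed

lemma F_1: "F 1 = 1"
proof -
  have "\<forall>\<^sub>F n in sequentially. root n (real (R (1 ^ n))) = 1"
    using eventually_gt_at_top[of 0] by eventually_elim (simp add: R_1)
  then have "(\<lambda>n. root n (real (R (1 ^ n)))) \<longlonglongrightarrow> 1" by (rule tendsto_eventually)
  then show ?thesis using F_tendsto LIMSEQ_unique by blast
qed

lemma F_power: "F (x ^ k) = F x ^ k"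
proof (cases "k = 0")
  case True then show ?thesis by (simp add: F_1)
next
  case False
  then have "strict_mono (\<lambda>n::nat. k * n)" by (auto simp: strict_mono_def)
  from LIMSEQ_subseq_LIMSEQ[OF F_tendsto this]
  have "(\<lambda>n. root (k * n) (real (R (x ^ (k * n)))) ^ k) \<longlonglongrightarrow> F x ^ k"
    by (intro tendsto_power) (simp add: o_def)
  moreover have "\<forall>\<^sub>F n in sequentially.
      root (k * n) (real (R (x ^ (k * n)))) ^ k = root n (real (R ((x ^ k) ^ n)))"
    using eventually_gt_at_top[of 0]
  proof eventually_elim
    case (elim n)
    have "root (k * n) r ^ k = root n r" if "r \<ge> 0" for r :: real
      using that False elim by (simp add: real_root_mult_exp)
    then show ?case by (simp add: power_mult)
  qed
  ultimately have "(\<lambda>n. root n (real (R ((x ^ k) ^ n)))) \<longlonglongrightarrow> F x ^ k"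
    by (simp add: tendsto_cong)
  then show ?thesis using F_tendsto LIMSEQ_unique by blast
qed

lemma R_sum: "R (sum f A) \<le> (\<Sum>i\<in>A. R (f i))"
proof (induction A rule: infinite_finite_induct)
  case (insert i A)
  then show ?case using R_add[of "f i" "sum f A"] by simp
qed (use R_of_nat[of 0] in auto)

lemma F_add: "F (x + y) \<le> F x + F y"
proof (rule field_le_epsilon)
  fix e :: real assume "e > 0"
  \<comment> \<open>\<open>F_bound\<close> needs strict room above \<open>F x\<close> and
    \<open>F y\<close>; the shift by e / 2 also makes a and b positive.\<close>
  define a b where "a = F x + e / 2" and "b = F y + e / 2"
  have ab: "a > 0" "b > 0" using F_nonneg[of x] F_nonneg[of y] \<open>e > 0\<close> by (auto simp: a_def b_def)
  obtain C where C: "C > 0" "\<And>n. real (R (x ^ n)) \<le> C * a ^ n"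
    using F_bound[of x a] \<open>e > 0\<close> by (auto simp: a_def)
  obtain D where D: "D > 0" "\<And>n. real (R (y ^ n)) \<le> D * b ^ n"
    using F_bound[of y b] \<open>e > 0\<close> by (auto simp: b_def)
  have "F (x + y) \<le> a + b"
  proof (rule F_leI)
    fix n
    have "real (R ((x + y) ^ n)) \<le> (\<Sum>k\<le>n. real (R (of_nat (n choose k) * x ^ k * y ^ (n - k))))"
      using R_sum[of "\<lambda>k. of_nat (n choose k) * x ^ k * y ^ (n - k)" "{..n}"]
      by (simp add: binomial_ring flip: of_nat_sum)
    also have "\<dots> \<le> (\<Sum>k\<le>n. real (n choose k) * (C * a ^ k) * (D * b ^ (n - k)))"
    proof (rule sum_mono)
      fix k
      have "R (of_nat (n choose k) * x ^ k * y ^ (n - k)) \<le> (n choose k) * (R (x ^ k) * R (y ^ (n - k)))"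
        using R_scale[of "n choose k" "x ^ k * y ^ (n - k)"] R_mult[of "x ^ k" "y ^ (n - k)"]
        by (metis mult.assoc mult_le_mono2 order_trans)
      then have "real (R (of_nat (n choose k) * x ^ k * y ^ (n - k))) \<le>
          real (n choose k) * (real (R (x ^ k)) * real (R (y ^ (n - k))))"
        by (simp flip: of_nat_mult)
      also have "\<dots> \<le> real (n choose k) * ((C * a ^ k) * (D * b ^ (n - k)))"
        using C D ab by (intro mult_left_mono mult_mono) auto
      finally show "real (R (of_nat (n choose k) * x ^ k * y ^ (n - k))) \<le>
          real (n choose k) * (C * a ^ k) * (D * b ^ (n - k))" by (simp add: ac_simps)
    qed
    also have "\<dots> = C * D * (a + b) ^ n"
      by (simp add: binomial_ring sum_distrib_left ac_simps)
    finally show "real (R ((x + y) ^ n)) \<le> (C * D) * real (n + 1) ^ 0 * (a + b) ^ n" by simp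
  qed (use ab in simp)
  then show "F (x + y) \<le> F x + F y + e" by (simp add: a_def b_def)
qed

section \<open>The asymptotic preorder\<close>

definition asymp_le :: "'b \<Rightarrow> 'b \<Rightarrow> bool" (infix "\<preceq>" 50) where
  "x \<preceq> y \<longleftrightarrow> (\<forall>z. F (x * z) \<le> F (y * z))"

lemma asymp_le_trans: "x \<preceq> y \<Longrightarrow> y \<preceq> z \<Longrightarrow> x \<preceq> z"
  unfolding asymp_le_def using order_trans by blast

text \<open>Compatibility with products is the reason for quantifying over z in the preorder.
  Smoothing compares values at \<open>f ^ n * x\<close>, so monotonicity survives it only for such a
  relation.\<close>

lemma asymp_le_mult_right: "x \<preceq> y \<Longrightarrow> x * z \<preceq> y * z"
  unfolding asymp_le_def by (metis mult.assoc)

lemma asymp_le_F: "x \<preceq> y \<Longrightarrow> F x \<le> F y"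
  unfolding asymp_le_def by (metis mult.right_neutral)

lemma asymp_le_one_mult: "1 \<preceq> x \<Longrightarrow> 1 \<preceq> y \<Longrightarrow> 1 \<preceq> x * y"
  using asymp_le_trans asymp_le_mult_right[of 1 x y] by simp

lemma asymp_le_one_power: "1 \<preceq> x \<Longrightarrow> 1 \<preceq> x ^ n"
  by (induction n) (auto simp: asymp_le_one_mult, simp add: asymp_le_def)

text \<open>The bound is asked for every z in order to be applied to \<open>z ^ n\<close>. The
  admissible polynomial factor leaves room for degenerations, whose order on n-th powers grows
  linearly in n.\<close>

lemma asymp_leI:
  assumes "\<And>n z. R (x ^ n * z) \<le> c * (n + 1) ^ k * R (y ^ n * z)"
  shows "x \<preceq> y"
  unfolding asymp_le_def
proof
  fix z
  show "F (x * z) \<le> F (y * z)"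
  proof (rule F_mono_asymp[where C = "real c" and k = k])
    fix n
    have "real (R ((x * z) ^ n)) \<le> real (c * (n + 1) ^ k * R ((y * z) ^ n))"
      using assms[of n "z ^ n"] by (simp only: power_mult_distrib of_nat_le_iff)
    then show "real (R ((x * z) ^ n)) \<le> real c * real (n + 1) ^ k * real (R ((y * z) ^ n))"
      by simp
  qed simp
qed

lemma asymp_le_add: "x \<preceq> x + y"
proof (rule asymp_leI[where c = 1 and k = 0])
  fix n z
  have "\<exists>w. (x + y) ^ n = x ^ n + w"
  proof (induction n)
    case (Suc n)
    then obtain w where "(x + y) ^ n = x ^ n + w" by blast
    then have "(x + y) ^ Suc n = x ^ Suc n + (x * w + y * (x + y) ^ n)"
      by (simp add: algebra_simps)
    then show ?case by blast
  qed (auto intro: exI[of _ 0])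
  then obtain w where "(x + y) ^ n = x ^ n + w" by blast
  then show "R (x ^ n * z) \<le> 1 * (n + 1) ^ 0 * R ((x + y) ^ n * z)"
    using R_le_add by (simp add: distrib_right)
qed

lemma F_of_nat: "F (of_nat m) = real m"
proof -
  have "\<forall>\<^sub>F n in sequentially. root n (real (R (of_nat m ^ n))) = real m"
    using eventually_gt_at_top[of 0]
  proof eventually_elim
    case (elim n)
    have "R (of_nat m ^ n) = m ^ n" using R_of_nat[of "m ^ n"] by simp
    then show ?case using elim by (simp add: real_root_power_cancel)
  qed
  then have "(\<lambda>n. root n (real (R (of_nat m ^ n)))) \<longlonglongrightarrow> real m" by (rule tendsto_eventually)
  then show ?thesis using F_tendsto LIMSEQ_unique by blast
qed

text \<open>If \<open>m\<close> copies of \<open>x\<close> have rank at most \<open>m * q\<close>, then \<open>m\<close> copies of \<open>x ^ (k + 1)\<close>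
  are dominated by \<open>q\<close> times \<open>m\<close> copies of \<open>x ^ k\<close>.\<close>

lemma F_le_of_R_scale:
  assumes "R (of_nat m * x) \<le> m * q" "m > 0"
  shows "F x \<le> real q"
proof -
  have *: "R (of_nat m * x ^ n) \<le> m * q ^ n" for n
  proof (induction n)
    case 0
    show ?case using R_of_nat by simp
  next
    case (Suc n)
    have "R (of_nat m * x ^ Suc n) = R ((of_nat m * x) * x ^ n)" by (simp add: ac_simps)
    also have "\<dots> \<le> R (of_nat (R (of_nat m * x)) * x ^ n)" by (rule R_mult_of_nat)
    also have "\<dots> \<le> R (of_nat (m * q) * x ^ n)" by (intro R_mono_scale assms)
    also have "\<dots> = R (of_nat q * (of_nat m * x ^ n))" by (simp add: ac_simps)
    also have "\<dots> \<le> q * R (of_nat m * x ^ n)" by (rule R_scale)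
    also have "\<dots> \<le> q * (m * q ^ n)" by (intro mult_le_mono2 Suc)
    finally show ?case by (simp add: ac_simps)
  qed
  show ?thesis
  proof (rule F_leI)
    fix n
    have "R (x ^ n) \<le> R (of_nat m * x ^ n)"
      using R_mono_scale[of 1 m "x ^ n"] \<open>m > 0\<close> by simp
    then have "R (x ^ n) \<le> m * q ^ n" using *[of n] by simp
    then have "real (R (x ^ n)) \<le> real (m * q ^ n)" by (simp only: of_nat_le_iff)
    then show "real (R (x ^ n)) \<le> real m * real (n + 1) ^ 0 * real q ^ n" by simp
  qed simp
qed

text \<open>The hard direction is the lower bound: an estimate for the rank of \<open>m ^ n\<close>
  copies of \<open>x ^ n\<close> is turned by \<open>F_le_of_R_scale\<close> into one for
  \<open>F (x ^ n)\<close>, so the copies cancel.\<close>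

lemma F_scale:
  assumes "1 \<preceq> x"
  shows "F (of_nat m * x) = real m * F x"
proof (rule antisym)
  show "F (of_nat m * x) \<le> real m * F x" using F_mult[of "of_nat m" x] by (simp add: F_of_nat)
  show "real m * F x \<le> F (of_nat m * x)"
  proof (cases "m = 0")
    case False
    have "real m \<le> F (of_nat m * x)"
      using asymp_le_F[OF asymp_le_mult_right[OF assms, of "of_nat m"]] by (simp add: F_of_nat ac_simps)
    have "F x \<le> F (of_nat m * x) / real m"
    proof (rule dense_ge)
      fix \<rho> assume \<rho>: "F (of_nat m * x) / real m < \<rho>"
      have "1 \<le> F (of_nat m * x) / real m"
        using \<open>real m \<le> F (of_nat m * x)\<close> False by simp
      then have "\<rho> \<ge> 1" using \<rho> by simp
      have "F (of_nat m * x) < real m * \<rho>" using \<rho> False by (simp add: field_simps)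
      then obtain C where C: "C > 0" "\<And>n. real (R ((of_nat m * x) ^ n)) \<le> C * (real m * \<rho>) ^ n"
        using F_bound by blast
      have "F x ^ n \<le> (C + 1) * real (n + 1) ^ 0 * \<rho> ^ n" for n
      proof -
        \<comment> \<open>\<open>F_le_of_R_scale\<close> wants an integer factor, hence the rounding
          up. Since 1 is below x, \<rho> is at least 1, and the rounding error is absorbed into
          \<open>\<rho> ^ n\<close>.\<close>
        define q where "q = nat \<lceil>C * \<rho> ^ n\<rceil>"
        have Cp: "C * \<rho> ^ n \<ge> 0" using C \<open>\<rho> \<ge> 1\<close> by simp
        have q: "C * \<rho> ^ n \<le> real q" "real q \<le> C * \<rho> ^ n + 1"
          unfolding q_def using Cp by linarith+
        have "real (R (of_nat (m ^ n) * x ^ n)) \<le> real m ^ n * (C * \<rho> ^ n)"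
          using C(2)[of n] by (simp add: power_mult_distrib ac_simps)
        also have "\<dots> \<le> real (m ^ n * q)" using q by (simp add: mult_left_mono)
        finally have "R (of_nat (m ^ n) * x ^ n) \<le> m ^ n * q" by (simp only: of_nat_le_iff)
        then have "F (x ^ n) \<le> real q" using False by (intro F_le_of_R_scale[of "m ^ n"]) auto
        then have "F x ^ n \<le> C * \<rho> ^ n + 1" using q by (simp add: F_power)
        also have "\<dots> \<le> C * \<rho> ^ n + \<rho> ^ n" using \<open>\<rho> \<ge> 1\<close> by simp
        finally show ?thesis by (simp add: algebra_simps)
      qed
      moreover have "0 \<le> \<rho>" using \<open>\<rho> \<ge> 1\<close> by simp
      ultimately show "F x \<le> \<rho>" using le_of_power_le[OF F_nonneg] by blast
    qed
    then show ?thesis using False by (simp add: field_simps)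
  qed (use F_nonneg in simp)
qed

section \<open>Power-multiplicative seminorms and their smoothing\<close>

definition power_seminorm :: "('b \<Rightarrow> real) \<Rightarrow> bool" where
  "power_seminorm G \<longleftrightarrow> (\<forall>x. 0 \<le> G x) \<and> G 1 = 1 \<and> (\<forall>x y. G (x * y) \<le> G x * G y)
     \<and> (\<forall>x k. G (x ^ k) = G x ^ k) \<and> (\<forall>x y. G (x + y) \<le> G x + G y)
     \<and> (\<forall>m x. 1 \<preceq> x \<longrightarrow> G (of_nat m * x) = real m * G x) \<and> (\<forall>x y. x \<preceq> y \<longrightarrow> G x \<le> G y)"

lemma power_seminorm_F: "power_seminorm F"
  unfolding power_seminorm_def
  using F_nonneg F_1 F_mult F_power F_add F_scale asymp_le_F by auto

definition multiplicative_at :: "('b \<Rightarrow> real) \<Rightarrow> 'b \<Rightarrow> bool" where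
  "multiplicative_at G f \<longleftrightarrow> (\<forall>g. G (f * g) = G f * G g)"

text \<open>Submultiplicativity makes the normalised values decrease, so their limit exists.
  Multiplying x by f shifts the index, which gives multiplicativity at f. An element at which
  \<open>G\<close> is already multiplicative pulls its value out of every term of the sequence, so
  it keeps value and multiplicativity and the construction can be iterated.\<close>

lemma smoothing:
  assumes G: "power_seminorm G" and f: "1 \<preceq> f"
  obtains H where "power_seminorm H" "\<And>x. H x \<le> G x" "H f = G f" "multiplicative_at H f"
    "\<And>h. multiplicative_at G h \<Longrightarrow> H h = G h \<and> multiplicative_at H h"
proof -
  have nn: "0 \<le> G x" and one: "G 1 = 1" and mult: "G (x * y) \<le> G x * G y"
    and pow: "G (x ^ k) = G x ^ k" and add: "G (x + y) \<le> G x + G y"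
    and scale: "1 \<preceq> x \<Longrightarrow> G (of_nat m * x) = real m * G x"
    and mono: "x \<preceq> y \<Longrightarrow> G x \<le> G y" for x y k m
    using G unfolding power_seminorm_def by blast+
  have f1: "1 \<le> G f" using mono[OF f] one by simp
  define s where "s x n = G (f ^ n * x) / G f ^ n" for x n
  define H where "H x = lim (s x)" for x
  have s0: "s x n \<ge> 0" for x n unfolding s_def using nn by simp
  have "decseq (s x)" for x
  proof (rule decseq_SucI)
    fix n
    have "G (f ^ Suc n * x) \<le> G f * G (f ^ n * x)" using mult[of f "f ^ n * x"] by (simp add: ac_simps)
    then have "s x (Suc n) \<le> G f * G (f ^ n * x) / G f ^ Suc n"
      unfolding s_def using f1 by (intro divide_right_mono) auto
    then show "s x (Suc n) \<le> s x n" using f1 by (simp add: s_def)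
  qed
  note dec = this
  have lim: "s x \<longlonglongrightarrow> H x" for x
  proof -
    obtain L where "s x \<longlonglongrightarrow> L"
      by (rule decseq_convergent[OF dec[of x], of 0]) (use s0 in auto)
    then show ?thesis unfolding H_def by (simp add: limI)
  qed
  have le_s: "H x \<le> s x n" for x n
    using decseq_ge[OF dec lim] .
  have H0: "0 \<le> H x" for x
    using lim by (rule LIMSEQ_le_const) (use s0 in blast)
  have Hmult: "H (x * y) \<le> H x * H y" for x y
  proof (rule tendsto_le[OF sequentially_bot tendsto_mult[OF lim lim]])
    \<comment> \<open>Along even indices \<open>f ^ (2 * n)\<close> supplies one factor
      \<open>f ^ n\<close> to x and one to y.\<close>
    have "strict_mono (\<lambda>n::nat. 2 * n)" by (auto simp: strict_mono_def)
    from LIMSEQ_subseq_LIMSEQ[OF lim this] show "(\<lambda>n. s (x * y) (2 * n)) \<longlonglongrightarrow> H (x * y)"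
      by (simp add: o_def)
    show "\<forall>\<^sub>F n in sequentially. s (x * y) (2 * n) \<le> s x n * s y n"
    proof (intro always_eventually allI)
      fix n
      have "G (f ^ (2 * n) * (x * y)) \<le> G (f ^ n * x) * G (f ^ n * y)"
        using mult[of "f ^ n * x" "f ^ n * y"]
        by (simp add: mult.assoc mult.left_commute power_mult power2_eq_square power_mult_distrib)
      then show "s (x * y) (2 * n) \<le> s x n * s y n"
        using f1 by (simp add: s_def mult_2 power_add divide_right_mono)
    qed
  qed
  have H1: "H 1 = 1"
  proof -
    have "s 1 = (\<lambda>n. 1)" using f1 by (auto simp: s_def pow)
    then show ?thesis using lim[of 1] by (simp add: LIMSEQ_const_iff)
  qed
  have Hpow: "H (x ^ k) = H x ^ k" for x k
  proof (cases "k = 0")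
    case False
    then have "strict_mono (\<lambda>n::nat. k * n)" by (auto simp: strict_mono_def)
    from LIMSEQ_subseq_LIMSEQ[OF lim this] have "(\<lambda>n. s (x ^ k) (k * n)) \<longlonglongrightarrow> H (x ^ k)"
      by (simp add: o_def)
    moreover have "s (x ^ k) (k * n) = s x n ^ k" for n
    proof -
      have "f ^ (k * n) * x ^ k = (f ^ n * x) ^ k"
        by (metis mult.commute power_mult power_mult_distrib)
      then show ?thesis by (simp add: s_def pow power_divide)
        (metis mult.commute power_mult)
    qed
    ultimately have "(\<lambda>n. s x n ^ k) \<longlonglongrightarrow> H (x ^ k)" by simp
    then show ?thesis using tendsto_power[OF lim, of x k] LIMSEQ_unique by blast
  qed (simp add: H1)
  have Hadd: "H (x + y) \<le> H x + H y" for x y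
  proof (rule tendsto_le[OF sequentially_bot tendsto_add[OF lim lim] lim])
    show "\<forall>\<^sub>F n in sequentially. s (x + y) n \<le> s x n + s y n"
    proof (intro always_eventually allI)
      fix n
      have "G (f ^ n * (x + y)) \<le> G (f ^ n * x) + G (f ^ n * y)"
        using add by (simp add: distrib_left)
      then show "s (x + y) n \<le> s x n + s y n"
        using f1 by (simp add: s_def divide_right_mono flip: add_divide_distrib)
    qed
  qed
  have Hscale: "H (of_nat m * x) = real m * H x" if "1 \<preceq> x" for m x
  proof -
    have "s (of_nat m * x) n = real m * s x n" for n
      using scale[of "f ^ n * x" m] asymp_le_one_mult[OF asymp_le_one_power[OF f] that]
      by (simp add: s_def ac_simps)
    then have "(\<lambda>n. real m * s x n) \<longlonglongrightarrow> H (of_nat m * x)" 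
      by (metis (no_types, lifting) ext lim)
    then show ?thesis using tendsto_mult_left[OF lim, of "real m" x] LIMSEQ_unique by blast
  qed
  have Hmono: "H x \<le> H y" if "x \<preceq> y" for x y
  proof (rule tendsto_le[OF sequentially_bot lim lim])
    show "\<forall>\<^sub>F n in sequentially. s x n \<le> s y n"
    proof (intro always_eventually allI)
      fix n
      have "G (f ^ n * x) \<le> G (f ^ n * y)"
        using mono[OF asymp_le_mult_right[OF that, of "f ^ n"]] by (simp add: ac_simps)
      then show "s x n \<le> s y n" using f1 by (simp add: s_def divide_right_mono)
    qed
  qed
  have Hkeep: "H h = G h \<and> multiplicative_at H h" if "multiplicative_at G h" for h
  proof -
    have step: "s (h * g) n = G h * s g n" for g n
      using that unfolding multiplicative_at_def s_def
      by (metis mult.left_commute times_divide_eq_right)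
    have eq: "H (h * g) = G h * H g" for g
    proof -
      have "(\<lambda>n. G h * s g n) \<longlonglongrightarrow> H (h * g)" by (metis (no_types, lifting) ext lim step)
      then show ?thesis using tendsto_mult_left[OF lim, of "G h" g] LIMSEQ_unique by blast
    qed
    then have "H h = G h" using eq[of 1] H1 by simp
    then show ?thesis using eq by (simp add: multiplicative_at_def)
  qed
  have Hf: "H (f * g) = G f * H g" for g
  proof -
    have "s (f * g) n = G f * s g (Suc n)" for n
      using f1 by (simp add: s_def ac_simps)
    then have "(\<lambda>n. G f * s g (Suc n)) \<longlonglongrightarrow> H (f * g)" by (metis (no_types, lifting) ext lim)
    then show ?thesis
      using tendsto_mult_left[OF LIMSEQ_Suc[OF lim], of "G f" g] LIMSEQ_unique by blast
  qed
  have "H f = G f" using Hf[of 1] H1 by simp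
  show ?thesis
  proof (rule that)
    show "power_seminorm H"
      unfolding power_seminorm_def using H0 H1 Hmult Hpow Hadd Hscale Hmono by blast
    show "H x \<le> G x" for x using le_s[of x 0] by (simp add: s_def)
    show "H f = G f" by fact
    show "multiplicative_at H f" using Hf \<open>H f = G f\<close> by (simp add: multiplicative_at_def)
  qed (use Hkeep in blast)
qed

text \<open>Each binomial term is evaluated exactly: the coefficient comes out by scaling, the power
  of a by multiplicativity at a, and what remains is a power of b. Being a summand of
  \<open>(a + b) ^ n\<close>, the term has value at most \<open>G (a + b) ^ n\<close>. There are n +
  1 terms, a factor that disappears under the n-th root.\<close>

lemma power_seminorm_superadditive:
  assumes G: "power_seminorm G" and "multiplicative_at G a" and "1 \<preceq> a" "1 \<preceq> b"
  shows "G a + G b \<le> G (a + b)"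
proof (rule le_of_power_le)
  have nn: "0 \<le> G x" and pow: "G (x ^ k) = G x ^ k"
    and scale: "1 \<preceq> x \<Longrightarrow> G (of_nat m * x) = real m * G x"
    and mono: "x \<preceq> y \<Longrightarrow> G x \<le> G y" for x y k m
    using G unfolding power_seminorm_def by blast+
  show "0 \<le> G a + G b" "0 \<le> G (a + b)" using nn by auto
  have one: "G 1 = 1" using G unfolding power_seminorm_def by blast
  have split: "G (a ^ i * x) = G a ^ i * G x" for i x
  proof (induction i)
    case (Suc i)
    have "G (a ^ Suc i * x) = G a * G (a ^ i * x)"
      using assms(2) by (simp add: multiplicative_at_def mult.assoc)
    then show ?case by (simp add: Suc mult.assoc)
  qed simp
  fix n
  have "(G a + G b) ^ n = (\<Sum>k\<le>n. real (n choose k) * G a ^ k * G b ^ (n - k))"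
    by (rule binomial_ring)
  also have "\<dots> \<le> (\<Sum>k\<le>n. G (a + b) ^ n)"
  proof (rule sum_mono)
    fix k assume "k \<in> {..n}"
    let ?w = "\<lambda>k. of_nat (n choose k) * a ^ k * b ^ (n - k)"
    have "real (n choose k) * G a ^ k * G b ^ (n - k) = G (?w k)"
      using scale[of "a ^ k * b ^ (n - k)" "n choose k"] assms(3,4)
      by (simp add: asymp_le_one_mult asymp_le_one_power split pow mult.assoc)
    also have "(a + b) ^ n = ?w k + (\<Sum>j\<in>{..n}-{k}. ?w j)"
      using \<open>k \<in> {..n}\<close> by (simp add: binomial_ring sum.remove)
    then have "G (?w k) \<le> G (a + b) ^ n"
      using mono[OF asymp_le_add] by (metis pow)
    finally show "real (n choose k) * G a ^ k * G b ^ (n - k) \<le> G (a + b) ^ n" .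
  qed
  finally show "(G a + G b) ^ n \<le> 1 * real (n + 1) ^ 1 * G (a + b) ^ n" by simp
qed

end

section \<open>Tensor rank\<close>

lemma tensor_rank_leI:
  assumes "finite S"
    and "\<And>i j k. i \<in> I \<Longrightarrow> j \<in> J \<Longrightarrow> k \<in> K \<Longrightarrow> T i j k = (\<Sum>s\<in>S. u s i * v s j * w s k)"
  shows "tensor_rank I J K T \<le> card S"
proof -
  obtain h where h: "bij_betw h {..<card S} S"
    using ex_bij_betw_nat_finite[OF \<open>finite S\<close>] by (auto simp: lessThan_atLeast0)
  have "rank_decomposition I J K T (card S)"
    unfolding rank_decomposition_def
  proof (intro exI ballI)
    fix i j k assume "i \<in> I" "j \<in> J" "k \<in> K"
    then show "T i j k = (\<Sum>s<card S. u (h s) i * v (h s) j * w (h s) k)"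
      using assms(2) sum.reindex_bij_betw[OF h, of "\<lambda>s. u s i * v s j * w s k"] by simp
  qed
  then show ?thesis unfolding tensor_rank_def by (rule Least_le)
qed

lemma rank_decomposition_card:
  assumes "finite I" "finite J" "finite K"
  shows "rank_decomposition I J K T (card (I \<times> J \<times> K))"
proof -
  define S where "S = I \<times> J \<times> K"
  have "finite S" using assms by (simp add: S_def)
  then obtain h where h: "bij_betw h {..<card S} S"
    using ex_bij_betw_nat_finite by (auto simp: lessThan_atLeast0)
  define u where "u s i = (if i = fst s then T (fst s) (fst (snd s)) (snd (snd s)) else 0)" for s i
  define v :: "_ \<Rightarrow> _ \<Rightarrow> 'd" where "v s j = (if j = fst (snd s) then 1 else 0)" for s :: "'a \<times> 'b \<times> 'c" and j
  define w :: "_ \<Rightarrow> _ \<Rightarrow> 'd" where "w s k = (if k = snd (snd s) then 1 else 0)" for s :: "'a \<times> 'b \<times> 'c" and k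
  have "rank_decomposition I J K T (card S)"
    unfolding rank_decomposition_def
  proof (intro exI ballI)
    fix i j k assume ijk: "i \<in> I" "j \<in> J" "k \<in> K"
    have "(\<Sum>s\<in>S. u s i * v s j * w s k) = (\<Sum>s\<in>S. if s = (i, j, k) then T i j k else 0)"
      by (intro sum.cong) (auto simp: u_def v_def w_def)
    also have "\<dots> = T i j k" using ijk \<open>finite S\<close> by (simp add: S_def)
    finally show "T i j k = (\<Sum>s<card S. u (h s) i * v (h s) j * w (h s) k)"
      using sum.reindex_bij_betw[OF h, of "\<lambda>s. u s i * v s j * w s k"] by simp
  qed
  then show ?thesis by (simp add: S_def)
qed

lemma tensor_rank_le_card:
  assumes "finite I" "finite J" "finite K"
  shows "tensor_rank I J K T \<le> card I * card J * card K"
  using Least_le[of "rank_decomposition I J K T", OF rank_decomposition_card[OF assms]]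
  by (simp add: tensor_rank_def card_cartesian_product mult.assoc)

lemma tensor_rankE:
  assumes "finite I" "finite J" "finite K"
  obtains u v w where "\<And>i j k. i \<in> I \<Longrightarrow> j \<in> J \<Longrightarrow> k \<in> K \<Longrightarrow>
      T i j k = (\<Sum>s<tensor_rank I J K T. u s i * v s j * w s k)"
proof -
  have "rank_decomposition I J K T (tensor_rank I J K T)"
    unfolding tensor_rank_def using rank_decomposition_card[OF assms] by (rule LeastI)
  then obtain u v w where "\<forall>i\<in>I. \<forall>j\<in>J. \<forall>k\<in>K. T i j k = (\<Sum>s<tensor_rank I J K T. u s i * v s j * w s k)"
    unfolding rank_decomposition_def by (elim exE)
  then show ?thesis by (intro that[of u v w]) simp
qed

lemma tensor_rank_pullback:
  assumes "finite I'" "finite J'" "finite K'"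
    and "\<And>i. i \<in> I \<Longrightarrow> \<phi> i \<in> I'" "\<And>j. j \<in> J \<Longrightarrow> \<psi> j \<in> J'" "\<And>k. k \<in> K \<Longrightarrow> \<chi> k \<in> K'"
    and "\<And>i j k. i \<in> I \<Longrightarrow> j \<in> J \<Longrightarrow> k \<in> K \<Longrightarrow> T i j k = T' (\<phi> i) (\<psi> j) (\<chi> k)"
  shows "tensor_rank I J K T \<le> tensor_rank I' J' K' T'"
proof -
  obtain u v w where "\<And>i j k. i \<in> I' \<Longrightarrow> j \<in> J' \<Longrightarrow> k \<in> K' \<Longrightarrow>
      T' i j k = (\<Sum>s<tensor_rank I' J' K' T'. u s i * v s j * w s k)"
    using assms(1-3) by (rule tensor_rankE) (rule that)
  then show ?thesis
    using tensor_rank_leI[of "{..<tensor_rank I' J' K' T'}" I J K T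
      "\<lambda>s i. u s (\<phi> i)" "\<lambda>s j. v s (\<psi> j)" "\<lambda>s k. w s (\<chi> k)"] assms by simp
qed

text \<open>The functions \<open>u s\<close> of a decomposition span the rows of an identity matrix.\<close>

lemma tensor_rank_ge_card:
  fixes T :: "('i, 'j, 'k, 'a::field) tensor"
  assumes fin: "finite I" "finite J" "finite K"
    and "\<And>i. i \<in> I \<Longrightarrow> \<psi> i \<in> J" "\<And>i. i \<in> I \<Longrightarrow> \<chi> i \<in> K"
    and T: "\<And>i i'. i \<in> I \<Longrightarrow> i' \<in> I \<Longrightarrow> T i (\<psi> i') (\<chi> i') = (if i = i' then 1 else 0)"
  shows "card I \<le> tensor_rank I J K T"
proof -
  define r where "r = tensor_rank I J K T"
  obtain u v w where uvw: "\<And>i j k. i \<in> I \<Longrightarrow> j \<in> J \<Longrightarrow> k \<in> K \<Longrightarrow>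
      T i j k = (\<Sum>s<r. u s i * v s j * w s k)"
    by (rule tensor_rankE[OF fin, of T, folded r_def]) (rule that)
  interpret vec: vector_space "\<lambda>(c::'a) (f::'i \<Rightarrow> 'a) i. c * f i"
    by unfold_locales (auto simp: fun_eq_iff algebra_simps)
  define e :: "'i \<Rightarrow> 'i \<Rightarrow> 'a" where "e i' = (\<lambda>i. if i = i' then 1 else 0)" for i'
  \<comment> \<open>Extension by zero: the functions \<open>e i'\<close> vanish outside I as well,
    so that equalities hold on the whole index type.\<close>
  define U where "U s = (\<lambda>i. if i \<in> I then u s i else 0)" for s
  have inj: "inj_on e I"
    by (rule inj_onI) (metis e_def one_neq_zero)
  have sum_apply: "(\<Sum>x\<in>S. g x) i = (\<Sum>x\<in>S. g x i)" for S :: "'x set" and g :: "'x \<Rightarrow> 'i \<Rightarrow> 'a" and i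
    by (induction S rule: infinite_finite_induct) auto
  have indep: "vec.independent (e ` I)"
  proof (rule vec.independent_if_scalars_zero)
    show "finite (e ` I)" using fin by simp
    fix f x assume z: "(\<Sum>x\<in>e ` I. (\<lambda>i. f x * x i)) = 0" and "x \<in> e ` I"
    then obtain i where i: "i \<in> I" "x = e i" by auto
    have "0 = (\<Sum>x\<in>e ` I. (\<lambda>i. f x * x i)) i" using z by simp
    also have "\<dots> = (\<Sum>i'\<in>I. f (e i') * e i' i)"
      by (simp add: sum_apply sum.reindex[OF inj])
    also have "\<dots> = (\<Sum>i'\<in>I. if i' = i then f (e i) else 0)"
      by (intro sum.cong) (auto simp: e_def)
    also have "\<dots> = f x" using i fin by simp
    finally show "f x = 0" by simp
  qed
  have "e ` I \<subseteq> vec.span (U ` {..<r})"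
  proof
    fix x assume "x \<in> e ` I"
    then obtain i' where i': "i' \<in> I" "x = e i'" by auto
    have "x = (\<Sum>s<r. (\<lambda>i. (v s (\<psi> i') * w s (\<chi> i')) * U s i))"
    proof
      fix i
      have "x i = (\<Sum>s<r. v s (\<psi> i') * w s (\<chi> i') * U s i)"
      proof (cases "i \<in> I")
        case True
        then have "x i = T i (\<psi> i') (\<chi> i')" using T[OF True i'(1)] by (simp add: i' e_def)
        also have "\<dots> = (\<Sum>s<r. u s i * v s (\<psi> i') * w s (\<chi> i'))"
          using True i' assms(4,5) by (intro uvw)
        also have "\<dots> = (\<Sum>s<r. v s (\<psi> i') * w s (\<chi> i') * U s i)"
          using True by (intro sum.cong) (simp_all add: U_def)
        finally show ?thesis .
      next
        case False
        then have "i \<noteq> i'" using i' by blast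
        then show ?thesis using False by (simp add: i' e_def U_def)
      qed
      then show "x i = (\<Sum>s<r. (\<lambda>i. (v s (\<psi> i') * w s (\<chi> i')) * U s i)) i"
        by (simp only: sum_apply)
    qed
    also have "\<dots> \<in> vec.span (U ` {..<r})"
      by (intro vec.span_sum vec.span_scale vec.span_base) auto
    finally show "x \<in> vec.span (U ` {..<r})" .
  qed
  then have "card (e ` I) \<le> card (U ` {..<r})"
    using vec.independent_span_bound[OF _ indep] by simp
  also have "\<dots> \<le> r" using card_image_le[of "{..<r}" U] by simp
  finally show ?thesis by (simp add: r_def card_image[OF inj])
qed

section \<open>The semiring of tensors\<close>

text \<open>A universal index type, closed under pairs and disjoint unions, lets all tensor formats live in one type.\<close>

datatype idx = Leaf nat | Pr idx idx | InL idx | InR idx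

type_synonym 'a raw = "idx list \<times> idx list \<times> idx list \<times> (idx \<Rightarrow> idx \<Rightarrow> idx \<Rightarrow> 'a)"

text \<open>Substitutions of indices suffice for the semiring laws; general linear maps enter only
  with degenerations. Keeping the index sets as lists makes them finite by type.\<close>

definition pullback :: "'a raw \<Rightarrow> 'a raw \<Rightarrow> bool" where
  "pullback = (\<lambda>(I, J, K, T) (I', J', K', T').
     \<exists>\<phi> \<psi> \<chi>. (\<forall>i\<in>set I. \<phi> i \<in> set I') \<and> (\<forall>j\<in>set J. \<psi> j \<in> set J') \<and> (\<forall>k\<in>set K. \<chi> k \<in> set K')
       \<and> (\<forall>i\<in>set I. \<forall>j\<in>set J. \<forall>k\<in>set K. T i j k = T' (\<phi> i) (\<psi> j) (\<chi> k)))"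

lemma pullbackI3:
  assumes "\<And>i. i \<in> set I \<Longrightarrow> \<phi> i \<in> set I'" "\<And>j. j \<in> set J \<Longrightarrow> \<psi> j \<in> set J'"
    "\<And>k. k \<in> set K \<Longrightarrow> \<chi> k \<in> set K'"
    "\<And>i j k. i \<in> set I \<Longrightarrow> j \<in> set J \<Longrightarrow> k \<in> set K \<Longrightarrow> T i j k = T' (\<phi> i) (\<psi> j) (\<chi> k)"
  shows "pullback (I, J, K, T) (I', J', K', T')"
  unfolding pullback_def prod.case
  by (intro exI[of _ \<phi>] exI[of _ \<psi>] exI[of _ \<chi>] conjI ballI) (use assms in auto)

lemmas pullbackI = pullbackI3[where \<phi> = \<phi> and \<psi> = \<phi> and \<chi> = \<phi> for \<phi>]

lemma pullbackE:
  assumes "pullback x y"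
  obtains I J K T I' J' K' T' \<phi> \<psi> \<chi> where "x = (I, J, K, T)" "y = (I', J', K', T')"
    "\<And>i. i \<in> set I \<Longrightarrow> \<phi> i \<in> set I'" "\<And>j. j \<in> set J \<Longrightarrow> \<psi> j \<in> set J'"
    "\<And>k. k \<in> set K \<Longrightarrow> \<chi> k \<in> set K'"
    "\<And>i j k. i \<in> set I \<Longrightarrow> j \<in> set J \<Longrightarrow> k \<in> set K \<Longrightarrow> T i j k = T' (\<phi> i) (\<psi> j) (\<chi> k)"
proof -
  obtain I J K T I' J' K' T' where xy: "x = (I, J, K, T)" "y = (I', J', K', T')"
    by (metis prod_cases4)
  from assms obtain \<phi> \<psi> \<chi> where "\<forall>i\<in>set I. \<phi> i \<in> set I'" "\<forall>j\<in>set J. \<psi> j \<in> set J'"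
    "\<forall>k\<in>set K. \<chi> k \<in> set K'"
    "\<forall>i\<in>set I. \<forall>j\<in>set J. \<forall>k\<in>set K. T i j k = T' (\<phi> i) (\<psi> j) (\<chi> k)"
    unfolding pullback_def xy prod.case by (elim exE conjE)
  then show ?thesis using that[OF xy, of \<phi> \<psi> \<chi>] by simp
qed

lemma pullback_refl: "pullback x x"
  by (cases x) (auto intro: pullbackI[where \<phi> = id])

lemma pullback_trans:
  assumes "pullback x y" "pullback y z"
  shows "pullback x z"
  using assms(1)
proof (rule pullbackE)
  fix I J K T I' J' K' T' \<phi> \<psi> \<chi>
  assume x: "x = (I, J, K, T)" "y = (I', J', K', T')"
    and 1: "\<And>i. i \<in> set I \<Longrightarrow> \<phi> i \<in> set I'" "\<And>j. j \<in> set J \<Longrightarrow> \<psi> j \<in> set J'"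
    "\<And>k. k \<in> set K \<Longrightarrow> \<chi> k \<in> set K'"
    "\<And>i j k. i \<in> set I \<Longrightarrow> j \<in> set J \<Longrightarrow> k \<in> set K \<Longrightarrow> T i j k = T' (\<phi> i) (\<psi> j) (\<chi> k)"
  obtain I'' J'' K'' T'' \<phi>' \<psi>' \<chi>' where z: "z = (I'', J'', K'', T'')"
    and 2: "\<And>i. i \<in> set I' \<Longrightarrow> \<phi>' i \<in> set I''" "\<And>j. j \<in> set J' \<Longrightarrow> \<psi>' j \<in> set J''"
    "\<And>k. k \<in> set K' \<Longrightarrow> \<chi>' k \<in> set K''"
    "\<And>i j k. i \<in> set I' \<Longrightarrow> j \<in> set J' \<Longrightarrow> k \<in> set K' \<Longrightarrow> T' i j k = T'' (\<phi>' i) (\<psi>' j) (\<chi>' k)"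
    using assms(2) unfolding x by (elim pullbackE) auto
  show ?thesis unfolding x z
    by (rule pullbackI3[where \<phi> = "\<phi>' \<circ> \<phi>" and \<psi> = "\<psi>' \<circ> \<psi>" and \<chi> = "\<chi>' \<circ> \<chi>"])
      (simp_all add: 1 2)
qed

text \<open>Coarser than relabelling of indices: repeating a slice of a tensor does not change its
  class. Rank is monotone under pullback, hence constant on classes.\<close>

definition equivalent :: "'a raw \<Rightarrow> 'a raw \<Rightarrow> bool" where
  "equivalent x y \<longleftrightarrow> pullback x y \<and> pullback y x"

quotient_type 'a tens = "'a raw" / equivalent
  by (rule equivpI)
    (auto simp: reflp_def symp_def transp_def equivalent_def intro: pullback_refl pullback_trans)

definition pairs :: "idx list \<Rightarrow> idx list \<Rightarrow> idx list" where
  "pairs I I' = [Pr i i'. i \<leftarrow> I, i' \<leftarrow> I']"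

definition summands :: "idx list \<Rightarrow> idx list \<Rightarrow> idx list" where
  "summands I I' = map InL I @ map InR I'"

lemma set_pairs: "set (pairs I I') = (\<lambda>(i, i'). Pr i i') ` (set I \<times> set I')"
  by (auto simp: pairs_def)

lemma set_summands: "set (summands I I') = InL ` set I \<union> InR ` set I'"
  by (simp add: summands_def)

lemma Pr_in_pairs [simp]: "Pr i i' \<in> set (pairs I I') \<longleftrightarrow> i \<in> set I \<and> i' \<in> set I'"
  by (auto simp: set_pairs)

lemma InL_in_summands [simp]: "InL i \<in> set (summands I I') \<longleftrightarrow> i \<in> set I"
  and InR_in_summands [simp]: "InR i \<in> set (summands I I') \<longleftrightarrow> i \<in> set I'"
  by (auto simp: set_summands)

lemma in_pairsE:
  assumes "x \<in> set (pairs I I')"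
  obtains i i' where "x = Pr i i'" "i \<in> set I" "i' \<in> set I'"
  using assms by (auto simp: set_pairs)

lemma in_summandsE:
  assumes "x \<in> set (summands I I')"
  obtains i where "x = InL i" "i \<in> set I" | i where "x = InR i" "i \<in> set I'"
  using assms by (auto simp: set_summands)

lemma sum_pairs: "(\<Sum>x\<in>set (pairs I I'). f x) = (\<Sum>i\<in>set I. \<Sum>i'\<in>set I'. f (Pr i i'))"
proof -
  have "inj_on (\<lambda>(i, i'). Pr i i') (set I \<times> set I')" by (auto intro: inj_onI)
  then show ?thesis
    by (simp add: set_pairs sum.reindex sum.cartesian_product case_prod_unfold)
qed

lemma sum_summands: "(\<Sum>x\<in>set (summands I I'). f x) = (\<Sum>i\<in>set I. f (InL i)) + (\<Sum>i\<in>set I'. f (InR i))"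
  unfolding set_summands by (subst sum.union_disjoint) (auto simp: sum.reindex inj_on_def)

lemma card_pairs: "card (set (pairs I I')) = card (set I) * card (set I')"
  unfolding set_pairs by (subst card_image) (auto simp: inj_on_def card_cartesian_product)

definition times_array :: "(idx \<Rightarrow> idx \<Rightarrow> idx \<Rightarrow> 'a) \<Rightarrow> (idx \<Rightarrow> idx \<Rightarrow> idx \<Rightarrow> 'a) \<Rightarrow> idx \<Rightarrow> idx \<Rightarrow> idx \<Rightarrow> 'a::field" where
  "times_array T T' i j k = (case (i, j, k) of
     (Pr i i', Pr j j', Pr k k') \<Rightarrow> T i j k * T' i' j' k' | _ \<Rightarrow> 0)"

definition plus_array :: "(idx \<Rightarrow> idx \<Rightarrow> idx \<Rightarrow> 'a) \<Rightarrow> (idx \<Rightarrow> idx \<Rightarrow> idx \<Rightarrow> 'a) \<Rightarrow> idx \<Rightarrow> idx \<Rightarrow> idx \<Rightarrow> 'a::field" where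
  "plus_array T T' i j k = (case (i, j, k) of
     (InL i, InL j, InL k) \<Rightarrow> T i j k | (InR i, InR j, InR k) \<Rightarrow> T' i j k | _ \<Rightarrow> 0)"

lemma times_array_simp [simp]:
  "times_array T T' (Pr i i') (Pr j j') (Pr k k') = T i j k * T' i' j' k'"
  by (simp add: times_array_def)

lemma plus_array_simps [simp]:
  "plus_array T T' (InL i) (InL j) (InL k) = T i j k"
  "plus_array T T' (InR i) (InR j) (InR k) = T' i j k"
  "plus_array T T' (InL i) (InR j) l = 0"
  "plus_array T T' (InR i) (InL j) l = 0"
  "plus_array T T' (InL i) l (InR k) = 0"
  "plus_array T T' (InR i) l (InL k) = 0"
  "plus_array T T' l (InL j) (InR k) = 0"
  "plus_array T T' l (InR j) (InL k) = 0"
  by (auto simp: plus_array_def split: idx.split)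

definition raw_times :: "'a::field raw \<Rightarrow> 'a raw \<Rightarrow> 'a raw" where
  "raw_times = (\<lambda>(I, J, K, T) (I', J', K', T'). (pairs I I', pairs J J', pairs K K', times_array T T'))"

definition raw_plus :: "'a::field raw \<Rightarrow> 'a raw \<Rightarrow> 'a raw" where
  "raw_plus = (\<lambda>(I, J, K, T) (I', J', K', T'). (summands I I', summands J J', summands K K', plus_array T T'))"

fun map_Pr :: "(idx \<Rightarrow> idx) \<Rightarrow> (idx \<Rightarrow> idx) \<Rightarrow> idx \<Rightarrow> idx" where
  "map_Pr f g (Pr i i') = Pr (f i) (g i')"
| "map_Pr f g x = x"

fun map_In :: "(idx \<Rightarrow> idx) \<Rightarrow> (idx \<Rightarrow> idx) \<Rightarrow> idx \<Rightarrow> idx" where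
  "map_In f g (InL i) = InL (f i)"
| "map_In f g (InR i) = InR (g i)"
| "map_In f g x = x"

lemma pullback_times:
  assumes "pullback x y" "pullback x' y'"
  shows "pullback (raw_times x x') (raw_times y y')"
  using assms(1)
proof (rule pullbackE)
  fix I J K T I1 J1 K1 T1 \<phi> \<psi> \<chi>
  assume x: "x = (I, J, K, T)" "y = (I1, J1, K1, T1)"
    and 1: "\<And>i. i \<in> set I \<Longrightarrow> \<phi> i \<in> set I1" "\<And>j. j \<in> set J \<Longrightarrow> \<psi> j \<in> set J1"
    "\<And>k. k \<in> set K \<Longrightarrow> \<chi> k \<in> set K1"
    "\<And>i j k. i \<in> set I \<Longrightarrow> j \<in> set J \<Longrightarrow> k \<in> set K \<Longrightarrow> T i j k = T1 (\<phi> i) (\<psi> j) (\<chi> k)"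
  obtain I' J' K' T' I1' J1' K1' T1' \<phi>' \<psi>' \<chi>' where x': "x' = (I', J', K', T')" "y' = (I1', J1', K1', T1')"
    and 2: "\<And>i. i \<in> set I' \<Longrightarrow> \<phi>' i \<in> set I1'" "\<And>j. j \<in> set J' \<Longrightarrow> \<psi>' j \<in> set J1'"
    "\<And>k. k \<in> set K' \<Longrightarrow> \<chi>' k \<in> set K1'"
    "\<And>i j k. i \<in> set I' \<Longrightarrow> j \<in> set J' \<Longrightarrow> k \<in> set K' \<Longrightarrow> T' i j k = T1' (\<phi>' i) (\<psi>' j) (\<chi>' k)"
    using assms(2) by (rule pullbackE) (rule that)
  show ?thesis unfolding x x' raw_times_def prod.case
    by (rule pullbackI3[where \<phi> = "map_Pr \<phi> \<phi>'" and \<psi> = "map_Pr \<psi> \<psi>'" and \<chi> = "map_Pr \<chi> \<chi>'"];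
      elim in_pairsE; simp add: 1 2)
qed

lemma pullback_plus:
  assumes "pullback x y" "pullback x' y'"
  shows "pullback (raw_plus x x') (raw_plus y y')"
  using assms(1)
proof (rule pullbackE)
  fix I J K T I1 J1 K1 T1 \<phi> \<psi> \<chi>
  assume x: "x = (I, J, K, T)" "y = (I1, J1, K1, T1)"
    and 1: "\<And>i. i \<in> set I \<Longrightarrow> \<phi> i \<in> set I1" "\<And>j. j \<in> set J \<Longrightarrow> \<psi> j \<in> set J1"
    "\<And>k. k \<in> set K \<Longrightarrow> \<chi> k \<in> set K1"
    "\<And>i j k. i \<in> set I \<Longrightarrow> j \<in> set J \<Longrightarrow> k \<in> set K \<Longrightarrow> T i j k = T1 (\<phi> i) (\<psi> j) (\<chi> k)"
  obtain I' J' K' T' I1' J1' K1' T1' \<phi>' \<psi>' \<chi>' where x': "x' = (I', J', K', T')" "y' = (I1', J1', K1', T1')"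
    and 2: "\<And>i. i \<in> set I' \<Longrightarrow> \<phi>' i \<in> set I1'" "\<And>j. j \<in> set J' \<Longrightarrow> \<psi>' j \<in> set J1'"
    "\<And>k. k \<in> set K' \<Longrightarrow> \<chi>' k \<in> set K1'"
    "\<And>i j k. i \<in> set I' \<Longrightarrow> j \<in> set J' \<Longrightarrow> k \<in> set K' \<Longrightarrow> T' i j k = T1' (\<phi>' i) (\<psi>' j) (\<chi>' k)"
    using assms(2) by (rule pullbackE) (rule that)
  show ?thesis unfolding x x' raw_plus_def prod.case
    by (rule pullbackI3[where \<phi> = "map_In \<phi> \<phi>'" and \<psi> = "map_In \<psi> \<psi>'" and \<chi> = "map_In \<chi> \<chi>'"];
      elim in_summandsE; simp add: 1 2)
qed

text \<open>This and the following functions are the index substitutions behind the semiring laws.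
  Swapping and reassociating act on pairs and on injections alike, so that one function serves the
  law for sums and the law for products.\<close>

fun swap_idx :: "idx \<Rightarrow> idx" where
  "swap_idx (Pr i j) = Pr j i" | "swap_idx (InL i) = InR i" | "swap_idx (InR i) = InL i"
| "swap_idx x = x"

fun assoc_idx :: "idx \<Rightarrow> idx" where
  "assoc_idx (Pr (Pr i j) k) = Pr i (Pr j k)"
| "assoc_idx (InL (InL i)) = InL i" | "assoc_idx (InL (InR i)) = InR (InL i)"
| "assoc_idx (InR i) = InR (InR i)"
| "assoc_idx x = x"

fun unassoc_idx :: "idx \<Rightarrow> idx" where
  "unassoc_idx (Pr i (Pr j k)) = Pr (Pr i j) k"
| "unassoc_idx (InL i) = InL (InL i)" | "unassoc_idx (InR (InL i)) = InL (InR i)"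
| "unassoc_idx (InR (InR i)) = InR i"
| "unassoc_idx x = x"

fun distrib_idx :: "idx \<Rightarrow> idx" where
  "distrib_idx (Pr (InL i) k) = InL (Pr i k)" | "distrib_idx (Pr (InR i) k) = InR (Pr i k)"
| "distrib_idx x = x"

fun undistrib_idx :: "idx \<Rightarrow> idx" where
  "undistrib_idx (InL (Pr i k)) = Pr (InL i) k" | "undistrib_idx (InR (Pr i k)) = Pr (InR i) k"
| "undistrib_idx x = x"

fun strip_idx :: "idx \<Rightarrow> idx" where
  "strip_idx (InR i) = i" | "strip_idx (Pr i j) = j" | "strip_idx x = x"

lemmas raw_defs = raw_times_def raw_plus_def

instantiation tens :: (field) comm_semiring_1
begin

lift_definition zero_tens :: "'a tens" is "([], [], [], \<lambda>_ _ _. 0)" .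

lift_definition one_tens :: "'a tens" is "([Leaf 0], [Leaf 0], [Leaf 0], \<lambda>_ _ _. 1)" .

lift_definition plus_tens :: "'a tens \<Rightarrow> 'a tens \<Rightarrow> 'a tens" is raw_plus
  by (simp add: equivalent_def pullback_plus)

lift_definition times_tens :: "'a tens \<Rightarrow> 'a tens \<Rightarrow> 'a tens" is raw_times
  by (simp add: equivalent_def pullback_times)

instance
proof
  fix a b c :: "'a tens"
  show "a + b + c = a + (b + c)"
  proof (transfer, unfold equivalent_def, intro conjI)
    fix a b c :: "'a raw"
    show "pullback (raw_plus (raw_plus a b) c) (raw_plus a (raw_plus b c))"
      by (cases a; cases b; cases c)
        (simp add: raw_defs, rule pullbackI[where \<phi> = assoc_idx]; elim in_summandsE; simp)
    show "pullback (raw_plus a (raw_plus b c)) (raw_plus (raw_plus a b) c)"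
      by (cases a; cases b; cases c)
        (simp add: raw_defs, rule pullbackI[where \<phi> = unassoc_idx]; elim in_summandsE; simp)
  qed
  show "a + b = b + a"
  proof (transfer, unfold equivalent_def)
    have "pullback (raw_plus a b) (raw_plus b a)" for a b :: "'a raw"
      by (cases a; cases b)
        (simp add: raw_defs, rule pullbackI[where \<phi> = swap_idx]; elim in_summandsE; simp)
    then show "pullback (raw_plus a b) (raw_plus b a) \<and> pullback (raw_plus b a) (raw_plus a b)"
      for a b :: "'a raw" by blast
  qed
  show "0 + a = a"
  proof (transfer, unfold equivalent_def, intro conjI)
    fix a :: "'a raw"
    show "pullback (raw_plus ([], [], [], \<lambda>_ _ _. 0) a) a"
      by (cases a) (simp add: raw_defs, rule pullbackI[where \<phi> = strip_idx]; elim in_summandsE; simp)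
    show "pullback a (raw_plus ([], [], [], \<lambda>_ _ _. 0) a)"
      by (cases a) (auto simp: raw_defs intro!: pullbackI[where \<phi> = InR])
  qed
  show "a * b * c = a * (b * c)"
  proof (transfer, unfold equivalent_def, intro conjI)
    fix a b c :: "'a raw"
    show "pullback (raw_times (raw_times a b) c) (raw_times a (raw_times b c))"
      by (cases a; cases b; cases c)
        (simp add: raw_defs, rule pullbackI[where \<phi> = assoc_idx]; elim in_pairsE; simp)
    show "pullback (raw_times a (raw_times b c)) (raw_times (raw_times a b) c)"
      by (cases a; cases b; cases c)
        (simp add: raw_defs, rule pullbackI[where \<phi> = unassoc_idx]; elim in_pairsE; simp)
  qed
  show comm: "a * b = b * a" for a b :: "'a tens"
  proof (transfer, unfold equivalent_def)
    have "pullback (raw_times a b) (raw_times b a)" for a b :: "'a raw"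
      by (cases a; cases b)
        (simp add: raw_defs, rule pullbackI[where \<phi> = swap_idx]; elim in_pairsE; simp)
    then show "pullback (raw_times a b) (raw_times b a) \<and> pullback (raw_times b a) (raw_times a b)"
      for a b :: "'a raw" by blast
  qed
  show "1 * a = a"
  proof (transfer, unfold equivalent_def, intro conjI)
    fix a :: "'a raw"
    show "pullback (raw_times ([Leaf 0], [Leaf 0], [Leaf 0], \<lambda>_ _ _. 1) a) a"
      by (cases a) (simp add: raw_defs, rule pullbackI[where \<phi> = strip_idx]; elim in_pairsE; simp)
    show "pullback a (raw_times ([Leaf 0], [Leaf 0], [Leaf 0], \<lambda>_ _ _. 1) a)"
      by (cases a) (auto simp: raw_defs intro!: pullbackI[where \<phi> = "Pr (Leaf 0)"])
  qed
  show "(a + b) * c = a * c + b * c"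
  proof (transfer, unfold equivalent_def, intro conjI)
    fix a b c :: "'a raw"
    show "pullback (raw_times (raw_plus a b) c) (raw_plus (raw_times a c) (raw_times b c))"
      by (cases a; cases b; cases c)
        (simp add: raw_defs, rule pullbackI[where \<phi> = distrib_idx]; elim in_pairsE in_summandsE; simp)
    show "pullback (raw_plus (raw_times a c) (raw_times b c)) (raw_times (raw_plus a b) c)"
      by (cases a; cases b; cases c)
        (simp add: raw_defs, rule pullbackI[where \<phi> = undistrib_idx]; elim in_pairsE in_summandsE; simp)
  qed
  show "0 * a = 0"
  proof (transfer, unfold equivalent_def, intro conjI)
    fix a :: "'a raw"
    show "pullback (raw_times ([], [], [], \<lambda>_ _ _. 0) a) ([], [], [], \<lambda>_ _ _. 0)"
      by (cases a) (simp add: raw_defs, rule pullbackI[where \<phi> = id]; elim in_pairsE; simp)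
    show "pullback ([], [], [], \<lambda>_ _ _. 0) (raw_times ([], [], [], \<lambda>_ _ _. 0) a)"
      by (cases a) (auto simp: raw_defs intro!: pullbackI[where \<phi> = id])
  qed
  then show "a * 0 = 0" by (simp add: comm[of a 0])
  show "(0 :: 'a tens) \<noteq> 1"
    by transfer (auto simp: equivalent_def pullback_def)
qed

end

section \<open>Rank on the semiring of tensors\<close>

lift_definition trank :: "'a::field tens \<Rightarrow> nat" is
  "\<lambda>(I, J, K, T). tensor_rank (set I) (set J) (set K) T"
proof -
  have "(case x of (I, J, K, T) \<Rightarrow> tensor_rank (set I) (set J) (set K) T) \<le>
      (case y of (I, J, K, T) \<Rightarrow> tensor_rank (set I) (set J) (set K) T)"
    if xy: "pullback x y" for x y :: "'a raw"
    using xy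
  proof (rule pullbackE)
    fix I J K T I' J' K' T' \<phi> \<psi> \<chi>
    assume x: "x = (I, J, K, T)" "y = (I', J', K', T')"
      and 1: "\<And>i. i \<in> set I \<Longrightarrow> \<phi> i \<in> set I'" "\<And>j. j \<in> set J \<Longrightarrow> \<psi> j \<in> set J'"
      "\<And>k. k \<in> set K \<Longrightarrow> \<chi> k \<in> set K'"
      "\<And>i j k. i \<in> set I \<Longrightarrow> j \<in> set J \<Longrightarrow> k \<in> set K \<Longrightarrow> T i j k = T' (\<phi> i) (\<psi> j) (\<chi> k)"
    show ?thesis unfolding x prod.case
      by (rule tensor_rank_pullback[where \<phi> = \<phi> and \<psi> = \<psi> and \<chi> = \<chi>]) (simp_all add: 1)
  qed
  then show "\<And>x y :: 'a raw. equivalent x y \<Longrightarrow> (case x of (I, J, K, T) \<Rightarrow> tensor_rank (set I) (set J) (set K) T) =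
      (case y of (I, J, K, T) \<Rightarrow> tensor_rank (set I) (set J) (set K) T)"
    by (simp add: equivalent_def antisym)
qed

lemma trank_abs: "trank (abs_tens (I, J, K, T)) = tensor_rank (set I) (set J) (set K) T"
  by (simp add: trank.abs_eq)

lemma abs_tens_eqI: "pullback x y \<Longrightarrow> pullback y x \<Longrightarrow> abs_tens x = abs_tens y"
  by (simp add: tens.abs_eq_iff equivalent_def)

lemma tens_cases:
  obtains I J K T where "x = abs_tens (I, J, K, T)"
  using tens.abs_induct[of "\<lambda>x. \<exists>I J K T. x = abs_tens (I, J, K, T)" x] by (metis prod_cases4)

lemma trank_pullback:
  assumes "pullback x y"
  shows "trank (abs_tens x) \<le> trank (abs_tens y)"
  using assms
proof (rule pullbackE)
  fix I J K T I' J' K' T' \<phi> \<psi> \<chi>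
  assume x: "x = (I, J, K, T)" "y = (I', J', K', T')"
    and 1: "\<And>i. i \<in> set I \<Longrightarrow> \<phi> i \<in> set I'" "\<And>j. j \<in> set J \<Longrightarrow> \<psi> j \<in> set J'"
    "\<And>k. k \<in> set K \<Longrightarrow> \<chi> k \<in> set K'"
    "\<And>i j k. i \<in> set I \<Longrightarrow> j \<in> set J \<Longrightarrow> k \<in> set K \<Longrightarrow> T i j k = T' (\<phi> i) (\<psi> j) (\<chi> k)"
  show ?thesis unfolding x trank_abs
    by (rule tensor_rank_pullback[where \<phi> = \<phi> and \<psi> = \<psi> and \<chi> = \<chi>]) (simp_all add: 1)
qed

lemma tensor_rank_plus_array:
  "tensor_rank (set (summands I I')) (set (summands J J')) (set (summands K K')) (plus_array T T')
    \<le> tensor_rank (set I) (set J) (set K) T + tensor_rank (set I') (set J') (set K') T'"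
proof -
  define r where "r = tensor_rank (set I) (set J) (set K) T"
  define r' where "r' = tensor_rank (set I') (set J') (set K') T'"
  obtain u v w where 1: "\<And>i j k. i \<in> set I \<Longrightarrow> j \<in> set J \<Longrightarrow> k \<in> set K \<Longrightarrow>
      T i j k = (\<Sum>s<r. u s i * v s j * w s k)"
    by (rule tensor_rankE[of "set I" "set J" "set K" T, folded r_def]) (auto intro: that)
  obtain u' v' w' where 2: "\<And>i j k. i \<in> set I' \<Longrightarrow> j \<in> set J' \<Longrightarrow> k \<in> set K' \<Longrightarrow>
      T' i j k = (\<Sum>s<r'. u' s i * v' s j * w' s k)"
    by (rule tensor_rankE[of "set I'" "set J'" "set K'" T', folded r'_def]) (auto intro: that)
  define g where "g u u' s x = (case s of Inl s \<Rightarrow> (case x of InL i \<Rightarrow> u s i | _ \<Rightarrow> 0)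
      | Inr s \<Rightarrow> (case x of InR i \<Rightarrow> u' s i | _ \<Rightarrow> 0))"
    for u u' :: "nat \<Rightarrow> idx \<Rightarrow> 'a" and s x
  have [simp]: "g u u' (Inl s) (InL i) = u s i" "g u u' (Inl s) (InR i) = 0"
    "g u u' (Inr s) (InR i) = u' s i" "g u u' (Inr s) (InL i) = 0" for u u' s i
    by (auto simp: g_def)
  have "tensor_rank (set (summands I I')) (set (summands J J')) (set (summands K K')) (plus_array T T')
      \<le> card ({..<r} <+> {..<r'})"
  proof (rule tensor_rank_leI)
    fix i j k assume "i \<in> set (summands I I')" "j \<in> set (summands J J')" "k \<in> set (summands K K')"
    then show "plus_array T T' i j k = (\<Sum>s\<in>{..<r} <+> {..<r'}. g u u' s i * g v v' s j * g w w' s k)"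
      by (elim in_summandsE; simp add: sum.Plus 1 2)
  qed simp
  then show ?thesis by (simp add: card_Plus r_def r'_def)
qed

lemma trank_add: "trank (x + y) \<le> trank x + trank y"
  by (cases x rule: tens_cases, cases y rule: tens_cases)
    (simp add: plus_tens.abs_eq raw_plus_def trank_abs tensor_rank_plus_array)

lemma trank_le_add: "trank x \<le> trank (x + y)"
proof (cases x rule: tens_cases, cases y rule: tens_cases)
  fix I J K T I' J' K' T' assume x: "x = abs_tens (I, J, K, T)" and y: "y = abs_tens (I', J', K', T')"
  show ?thesis unfolding x y plus_tens.abs_eq
    by (intro trank_pullback) (simp add: raw_plus_def, rule pullbackI[where \<phi> = InL]; simp)
qed

definition raw_unit :: "nat \<Rightarrow> 'a::field raw" where
  "raw_unit n = (map Leaf [0..<n], map Leaf [0..<n], map Leaf [0..<n],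
     \<lambda>i j k. if i = j \<and> j = k then 1 else 0)"

lemma sum_Leaf: "(\<Sum>x\<in>set (map Leaf [0..<n]). f x) = (\<Sum>i<n. f (Leaf i))"
  by (simp add: sum.reindex inj_on_def lessThan_atLeast0)

text \<open>Identifies the numerals of the semiring with the diagonal tensors, so that
  multiplication by a numeral is both a direct sum of copies and a product with a unit
  tensor.\<close>

lemma of_nat_tens: "of_nat n = abs_tens (raw_unit n)"
proof (induction n)
  case 0
  show ?case unfolding of_nat_0 zero_tens.abs_eq
    by (rule abs_tens_eqI) (simp_all add: raw_unit_def pullback_def)
next
  case (Suc n)
  \<comment> \<open>The single index of the added 1 becomes the new last index
    \<open>Leaf n\<close>; g is the inverse on the indices that occur.\<close>
  define f where "f x = (case x of InL x \<Rightarrow> Leaf n | InR x \<Rightarrow> x | x \<Rightarrow> x)" for x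
  define g where "g x = (if x = Leaf n then InL (Leaf 0) else InR x)" for x
  have "of_nat (Suc n) = 1 + (of_nat n :: 'a tens)" by simp
  also have "\<dots> = abs_tens (raw_plus ([Leaf 0], [Leaf 0], [Leaf 0], \<lambda>_ _ _. 1) (raw_unit n))"
    by (simp only: Suc one_tens.abs_eq plus_tens.abs_eq)
  also have "\<dots> = abs_tens (raw_unit (Suc n))"
  proof (rule abs_tens_eqI; unfold raw_unit_def raw_plus_def prod.case)
    show "pullback (summands [Leaf 0] (map Leaf [0..<n]), summands [Leaf 0] (map Leaf [0..<n]),
        summands [Leaf 0] (map Leaf [0..<n]),
        plus_array (\<lambda>_ _ _. 1) (\<lambda>i j k. if i = j \<and> j = k then 1 else 0))
       (map Leaf [0..<Suc n], map Leaf [0..<Suc n], map Leaf [0..<Suc n],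
        \<lambda>i j k. if i = j \<and> j = k then 1::'a else 0)"
      by (rule pullbackI[where \<phi> = f]; elim in_summandsE; auto simp: f_def)
    show "pullback (map Leaf [0..<Suc n], map Leaf [0..<Suc n], map Leaf [0..<Suc n],
        \<lambda>i j k. if i = j \<and> j = k then 1::'a else 0)
       (summands [Leaf 0] (map Leaf [0..<n]), summands [Leaf 0] (map Leaf [0..<n]),
        summands [Leaf 0] (map Leaf [0..<n]),
        plus_array (\<lambda>_ _ _. 1) (\<lambda>i j k. if i = j \<and> j = k then 1 else 0))"
      by (rule pullbackI[where \<phi> = g]) (auto simp: g_def)
  qed
  finally show ?case .
qed

lemma trank_of_nat: "trank (of_nat n :: 'a::field tens) = n"
proof -
  let ?L = "set (map Leaf [0..<n])" and ?\<delta> = "\<lambda>i j k. if i = j \<and> j = k then 1 else 0 :: 'a"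
  have card: "card ?L = n" by (simp add: card_image inj_on_def)
  have "tensor_rank ?L ?L ?L ?\<delta> \<le> card ?L"
  proof (rule tensor_rank_leI[where u = "\<lambda>s i. if i = s then 1 else 0" and v = "\<lambda>s i. if i = s then 1 else 0"
        and w = "\<lambda>s i. if i = s then 1 else 0"])
    fix i j k assume "i \<in> ?L"
    have "(\<Sum>s\<in>?L. (if i = s then 1 else 0) * (if j = s then 1 else 0) * (if k = s then 1 else 0)) =
        (\<Sum>s\<in>?L. if s = i then ?\<delta> i j k else 0)"
      by (intro sum.cong) auto
    then show "?\<delta> i j k = (\<Sum>s\<in>?L. (if i = s then 1 else 0) * (if j = s then 1 else 0) * (if k = s then 1 else 0))"
      using \<open>i \<in> ?L\<close> by (simp only: sum.delta finite_set if_True)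
  qed simp
  moreover have "card ?L \<le> tensor_rank ?L ?L ?L ?\<delta>"
    by (rule tensor_rank_ge_card[where \<psi> = id and \<chi> = id]) auto
  ultimately show ?thesis unfolding of_nat_tens raw_unit_def trank_abs card by simp
qed

section \<open>Degenerations\<close>

text \<open>The polynomial variable plays the role of the infinitesimal: up to higher order terms,
  \<open>x\<close> times its \<open>h\<close>-th power is a restriction of \<open>y\<close>.\<close>

definition degenerates :: "nat \<Rightarrow> 'a::field raw \<Rightarrow> 'a raw \<Rightarrow> bool" where
  "degenerates h = (\<lambda>(I', J', K', T') (I, J, K, T).
     \<exists>\<alpha> \<beta> \<gamma> :: idx \<Rightarrow> idx \<Rightarrow> 'a poly. \<forall>i\<in>set I'. \<forall>j\<in>set J'. \<forall>k\<in>set K'. \<exists>q.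
       (\<Sum>a\<in>set I. \<Sum>b\<in>set J. \<Sum>c\<in>set K. \<alpha> i a * \<beta> j b * \<gamma> k c * [:T a b c:])
         = monom 1 h * ([:T' i j k:] + [:0, 1:] * q))"

lemma degeneratesI:
  assumes "\<And>i j k. i \<in> set I' \<Longrightarrow> j \<in> set J' \<Longrightarrow> k \<in> set K' \<Longrightarrow> \<exists>q.
       (\<Sum>a\<in>set I. \<Sum>b\<in>set J. \<Sum>c\<in>set K. \<alpha> i a * \<beta> j b * \<gamma> k c * [:T a b c:])
         = monom 1 h * ([:T' i j k:] + [:0, 1:] * q)"
  shows "degenerates h (I', J', K', T') (I, J, K, T)"
  unfolding degenerates_def prod.case
  by (intro exI[of _ \<alpha>] exI[of _ \<beta>] exI[of _ \<gamma>] ballI assms)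

lemma degeneratesE:
  assumes "degenerates h (I', J', K', T') (I, J, K, T)"
  obtains \<alpha> \<beta> \<gamma> q where "\<And>i j k. i \<in> set I' \<Longrightarrow> j \<in> set J' \<Longrightarrow> k \<in> set K' \<Longrightarrow>
       (\<Sum>a\<in>set I. \<Sum>b\<in>set J. \<Sum>c\<in>set K. \<alpha> i a * \<beta> j b * \<gamma> k c * [:T a b c:])
         = monom 1 h * ([:T' i j k:] + [:0, 1:] * q i j k)"
proof -
  from assms obtain \<alpha> \<beta> \<gamma> where *: "\<forall>i\<in>set I'. \<forall>j\<in>set J'. \<forall>k\<in>set K'. \<exists>q.
       (\<Sum>a\<in>set I. \<Sum>b\<in>set J. \<Sum>c\<in>set K. \<alpha> i a * \<beta> j b * \<gamma> k c * [:T a b c:])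
         = monom 1 h * ([:T' i j k:] + [:0, 1:] * q)"
    unfolding degenerates_def prod.case by (elim exE)
  define q where "q i j k = (SOME q. (\<Sum>a\<in>set I. \<Sum>b\<in>set J. \<Sum>c\<in>set K. \<alpha> i a * \<beta> j b * \<gamma> k c * [:T a b c:])
         = monom 1 h * ([:T' i j k:] + [:0, 1:] * q))" for i j k
  show ?thesis
    by (rule that[of \<alpha> \<beta> \<gamma> q], unfold q_def, rule someI_ex) (use * in simp)
qed

lemma const_poly_sum: "[:sum f A:] = (\<Sum>x\<in>A. [:f x:])"
proof (induction A rule: infinite_finite_induct)
  case (insert x A)
  have "[:sum f (insert x A):] = [:f x:] + [:sum f A:]" using insert.hyps by simp
  also have "\<dots> = (\<Sum>x\<in>insert x A. [:f x:])" unfolding insert.IH using insert.hyps by simp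
  finally show ?case .
qed simp_all

lemma sum3_mult_left:
  fixes f g h :: "_ \<Rightarrow> 'b::comm_semiring_1"
  shows "(\<Sum>a\<in>A. \<Sum>b\<in>B. \<Sum>c\<in>C. f a * g b * h c) = sum f A * sum g B * sum h C"
  by (simp only: mult.assoc sum_distrib_left[symmetric] sum_distrib_right[symmetric])

text \<open>The coefficient of degree \<open>h\<close> of a product of three polynomials is a sum of at most
  \<open>(h + 1)\<^sup>2\<close> products of coefficients, so no interpolation is needed.\<close>

lemma degenerates_rank:
  assumes "degenerates h x y"
  shows "trank (abs_tens x) \<le> (h + 1)\<^sup>2 * trank (abs_tens y)"
proof -
  obtain I J K T I' J' K' T' where xy: "y = (I, J, K, T)" "x = (I', J', K', T')"
    by (metis prod_cases4)
  obtain \<alpha> \<beta> \<gamma> q where deg: "\<And>i j k. i \<in> set I' \<Longrightarrow> j \<in> set J' \<Longrightarrow> k \<in> set K' \<Longrightarrow>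
       (\<Sum>a\<in>set I. \<Sum>b\<in>set J. \<Sum>c\<in>set K. \<alpha> i a * \<beta> j b * \<gamma> k c * [:T a b c:])
         = monom 1 h * ([:T' i j k:] + [:0, 1:] * q i j k)"
    using assms unfolding xy by (rule degeneratesE) (rule that)
  define r where "r = tensor_rank (set I) (set J) (set K) T"
  obtain u v w where T: "\<And>i j k. i \<in> set I \<Longrightarrow> j \<in> set J \<Longrightarrow> k \<in> set K \<Longrightarrow>
      T i j k = (\<Sum>s<r. u s i * v s j * w s k)"
    by (rule tensor_rankE[of "set I" "set J" "set K" T, folded r_def]) (auto intro: that)
  define U where "U s i = (\<Sum>a\<in>set I. \<alpha> i a * [:u s a:])" for s i
  define V where "V s j = (\<Sum>b\<in>set J. \<beta> j b * [:v s b:])" for s j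
  define W where "W s k = (\<Sum>c\<in>set K. \<gamma> k c * [:w s c:])" for s k
  define S where "S = {..<r} \<times> (SIGMA a:{..h}. {..h - a})"
  have "tensor_rank (set I') (set J') (set K') T' \<le> card S"
  proof (rule tensor_rank_leI[where u = "\<lambda>(s, a, b) i. coeff (U s i) a"
        and v = "\<lambda>(s, a, b) j. coeff (V s j) b" and w = "\<lambda>(s, a, b) k. coeff (W s k) (h - a - b)"])
    fix i j k assume ijk: "i \<in> set I'" "j \<in> set J'" "k \<in> set K'"
    have "(\<Sum>a\<in>set I. \<Sum>b\<in>set J. \<Sum>c\<in>set K. \<alpha> i a * \<beta> j b * \<gamma> k c * [:T a b c:])
        = (\<Sum>a\<in>set I. \<Sum>b\<in>set J. \<Sum>c\<in>set K. \<Sum>s<r.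
            (\<alpha> i a * [:u s a:]) * (\<beta> j b * [:v s b:]) * (\<gamma> k c * [:w s c:]))"
      by (intro sum.cong refl) (simp add: T const_poly_sum sum_distrib_left mult_ac)
    also have "\<dots> = (\<Sum>s<r. \<Sum>a\<in>set I. \<Sum>b\<in>set J. \<Sum>c\<in>set K.
            (\<alpha> i a * [:u s a:]) * (\<beta> j b * [:v s b:]) * (\<gamma> k c * [:w s c:]))"
      by (simp only: sum.swap[where B = "{..<r}"])
    also have "\<dots> = (\<Sum>s<r. U s i * V s j * W s k)"
      by (simp only: sum3_mult_left U_def V_def W_def)
    finally have sum_eq: "monom 1 h * ([:T' i j k:] + [:0, 1:] * q i j k) = (\<Sum>s<r. U s i * V s j * W s k)"
      unfolding deg[OF ijk] .
    have "T' i j k = coeff (monom 1 h * ([:T' i j k:] + [:0, 1:] * q i j k)) h"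
      by (subst coeff_monom_mult) simp
    also have "\<dots> = coeff (\<Sum>s<r. U s i * (V s j * W s k)) h"
      by (simp only: sum_eq mult.assoc)
    also have "\<dots> = (\<Sum>s<r. \<Sum>a\<le>h. \<Sum>b\<le>h - a. coeff (U s i) a * coeff (V s j) b * coeff (W s k) (h - a - b))"
      by (simp add: coeff_sum coeff_mult sum_distrib_left mult.assoc)
    also have "\<dots> = (\<Sum>(s, a, b)\<in>S. coeff (U s i) a * coeff (V s j) b * coeff (W s k) (h - a - b))"
      unfolding S_def by (simp add: sum.Sigma sum.cartesian_product case_prod_unfold)
    finally show "T' i j k = (\<Sum>s\<in>S. (case s of (s, a, b) \<Rightarrow> \<lambda>i. coeff (U s i) a) i *
        (case s of (s, a, b) \<Rightarrow> \<lambda>j. coeff (V s j) b) j *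
        (case s of (s, a, b) \<Rightarrow> \<lambda>k. coeff (W s k) (h - a - b)) k)"
      by (simp add: case_prod_unfold)
  qed (simp add: S_def)
  also have "card S \<le> card ({..<r} \<times> ({..h} \<times> {..h}))"
    by (rule card_mono) (auto simp: S_def)
  also have "\<dots> = (h + 1)\<^sup>2 * r" by (simp add: card_cartesian_product power2_eq_square)
  finally show ?thesis by (simp add: xy trank_abs r_def)
qed

text \<open>Over index pairs the contraction factors into the two given ones. The orders add, and in
  the product of the two expansions everything but the product of the leading coefficients retains a
  factor of the variable.\<close>

lemma degenerates_times:
  assumes "degenerates h1 x y" "degenerates h2 x' y'"
  shows "degenerates (h1 + h2) (raw_times x x') (raw_times y y')"
proof -
  obtain I J K T I1 J1 K1 T1 where xy: "y = (I, J, K, T)" "x = (I1, J1, K1, T1)"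
    by (metis prod_cases4)
  obtain I' J' K' T' I1' J1' K1' T1' where xy': "y' = (I', J', K', T')" "x' = (I1', J1', K1', T1')"
    by (metis prod_cases4)
  obtain \<alpha> \<beta> \<gamma> q where 1: "\<And>i j k. i \<in> set I1 \<Longrightarrow> j \<in> set J1 \<Longrightarrow> k \<in> set K1 \<Longrightarrow>
       (\<Sum>a\<in>set I. \<Sum>b\<in>set J. \<Sum>c\<in>set K. \<alpha> i a * \<beta> j b * \<gamma> k c * [:T a b c:])
         = monom 1 h1 * ([:T1 i j k:] + [:0, 1:] * q i j k)"
    using assms(1) unfolding xy by (rule degeneratesE) (rule that)
  obtain \<alpha>' \<beta>' \<gamma>' q' where 2: "\<And>i j k. i \<in> set I1' \<Longrightarrow> j \<in> set J1' \<Longrightarrow> k \<in> set K1' \<Longrightarrow>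
       (\<Sum>a\<in>set I'. \<Sum>b\<in>set J'. \<Sum>c\<in>set K'. \<alpha>' i a * \<beta>' j b * \<gamma>' k c * [:T' a b c:])
         = monom 1 h2 * ([:T1' i j k:] + [:0, 1:] * q' i j k)"
    using assms(2) unfolding xy' by (rule degeneratesE) (rule that)
  define g where "g \<alpha> \<alpha>' i a = (case (i, a) of (Pr i i', Pr a a') \<Rightarrow> \<alpha> i a * \<alpha>' i' a' | _ \<Rightarrow> 0)"
    for \<alpha> \<alpha>' :: "idx \<Rightarrow> idx \<Rightarrow> 'a poly" and i a
  have [simp]: "g \<alpha> \<alpha>' (Pr i i') (Pr a a') = \<alpha> i a * \<alpha>' i' a'" for \<alpha> \<alpha>' i i' a a'
    by (simp add: g_def)
  show ?thesis unfolding xy xy' raw_times_def prod.case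
  proof (rule degeneratesI[where \<alpha> = "g \<alpha> \<alpha>'" and \<beta> = "g \<beta> \<beta>'" and \<gamma> = "g \<gamma> \<gamma>'"])
    fix x y z assume "x \<in> set (pairs I1 I1')" "y \<in> set (pairs J1 J1')" "z \<in> set (pairs K1 K1')"
    then obtain i i' j j' k k' where
      xyz: "x = Pr i i'" "y = Pr j j'" "z = Pr k k'" and
      ijk: "i \<in> set I1" "j \<in> set J1" "k \<in> set K1" and
      ijk': "i' \<in> set I1'" "j' \<in> set J1'" "k' \<in> set K1'"
      by (elim in_pairsE)
    let ?e = "[:0, 1 :: 'a:]"
    let ?F = "\<lambda>a b c. \<alpha> i a * \<beta> j b * \<gamma> k c * [:T a b c:]"
    let ?F' = "\<lambda>a b c. \<alpha>' i' a * \<beta>' j' b * \<gamma>' k' c * [:T' a b c:]"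
    have mm: "monom 1 (h1 + h2) = monom 1 h1 * monom (1 :: 'a) h2" by (simp add: mult_monom)
    have expand: "(A + e * q) * (B + e * q') = A * B + e * (A * q' + q * (B + e * q'))"
      for A B e q q' :: "'a poly" by (simp add: algebra_simps)
    have "(\<Sum>a\<in>set (pairs I I'). \<Sum>b\<in>set (pairs J J'). \<Sum>c\<in>set (pairs K K').
        g \<alpha> \<alpha>' x a * g \<beta> \<beta>' y b * g \<gamma> \<gamma>' z c * [:times_array T T' a b c:])
      = (\<Sum>a\<in>set I. \<Sum>a'\<in>set I'. \<Sum>b\<in>set J. \<Sum>b'\<in>set J'. \<Sum>c\<in>set K. \<Sum>c'\<in>set K'. ?F a b c * ?F' a' b' c')"
      unfolding sum_pairs xyz by (intro sum.cong refl) (simp add: mult_ac)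
    also have "\<dots> = (\<Sum>a\<in>set I. \<Sum>b\<in>set J. \<Sum>c\<in>set K. ?F a b c) * (\<Sum>a\<in>set I'. \<Sum>b\<in>set J'. \<Sum>c\<in>set K'. ?F' a b c)"
      by (simp only: sum_product[symmetric])
    also have "\<dots> = monom 1 (h1 + h2) * (([:T1 i j k:] + ?e * q i j k) * ([:T1' i' j' k':] + ?e * q' i' j' k'))"
      unfolding 1[OF ijk] 2[OF ijk'] mm by (simp only: mult_ac)
    also have "([:T1 i j k:] + ?e * q i j k) * ([:T1' i' j' k':] + ?e * q' i' j' k') =
        [:T1 i j k * T1' i' j' k':] + ?e * ([:T1 i j k:] * q' i' j' k' + q i j k * ([:T1' i' j' k':] + ?e * q' i' j' k'))"
      unfolding expand by simp
    finally show "\<exists>q. (\<Sum>a\<in>set (pairs I I'). \<Sum>b\<in>set (pairs J J'). \<Sum>c\<in>set (pairs K K').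
        g \<alpha> \<alpha>' x a * g \<beta> \<beta>' y b * g \<gamma> \<gamma>' z c * [:times_array T T' a b c:]) =
        monom 1 (h1 + h2) * ([:times_array T1 T1' x y z:] + [:0, 1:] * q)"
      unfolding xyz times_array_simp by blast
  qed
qed

lemma sum_indicator_mult:
  fixes g :: "_ \<Rightarrow> 'b::comm_semiring_1"
  assumes "finite A" "x \<in> A"
  shows "(\<Sum>a\<in>A. (if a = x then 1 else 0) * g a) = g x"
proof -
  have "(\<Sum>a\<in>A. (if a = x then 1 else 0) * g a) = (\<Sum>a\<in>A. if a = x then g x else 0)"
    by (intro sum.cong) auto
  then show ?thesis using assms by simp
qed

lemma degenerates_pullback:
  assumes "pullback x y"
  shows "degenerates 0 x y"
  using assms
proof (rule pullbackE)
  fix I J K T I' J' K' T' \<phi> \<psi> \<chi>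
  assume x: "x = (I, J, K, T)" "y = (I', J', K', T')"
    and 1: "\<And>i. i \<in> set I \<Longrightarrow> \<phi> i \<in> set I'" "\<And>j. j \<in> set J \<Longrightarrow> \<psi> j \<in> set J'"
    "\<And>k. k \<in> set K \<Longrightarrow> \<chi> k \<in> set K'"
    "\<And>i j k. i \<in> set I \<Longrightarrow> j \<in> set J \<Longrightarrow> k \<in> set K \<Longrightarrow> T i j k = T' (\<phi> i) (\<psi> j) (\<chi> k)"
  show ?thesis unfolding x
  proof (rule degeneratesI[where \<alpha> = "\<lambda>i a. if a = \<phi> i then 1 else 0"
        and \<beta> = "\<lambda>i a. if a = \<psi> i then 1 else 0" and \<gamma> = "\<lambda>i a. if a = \<chi> i then 1 else 0"])
    fix i j k assume ijk: "i \<in> set I" "j \<in> set J" "k \<in> set K"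
    have "(\<Sum>a\<in>set I'. \<Sum>b\<in>set J'. \<Sum>c\<in>set K'. (if a = \<phi> i then 1 else 0) *
        (if b = \<psi> j then 1 else 0) * (if c = \<chi> k then 1 else 0) * [:T' a b c:]) = [:T i j k:]"
      by (simp only: mult.assoc sum_distrib_left[symmetric] sum_indicator_mult finite_set 1 ijk)
    then show "\<exists>q. (\<Sum>a\<in>set I'. \<Sum>b\<in>set J'. \<Sum>c\<in>set K'. (if a = \<phi> i then 1 else 0) *
        (if b = \<psi> j then 1 else 0) * (if c = \<chi> k then 1 else 0) * [:T' a b c:]) =
        monom 1 0 * ([:T i j k:] + [:0, 1:] * q)"
      by (intro exI[of _ 0]) simp
  qed
qed

text \<open>The vectors of a rank decomposition of length r are the columns of three linear maps
  that restrict the diagonal tensor of size r to the given tensor.\<close>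

lemma degenerates_unit: "degenerates 0 (I, J, K, T) (raw_unit (tensor_rank (set I) (set J) (set K) T))"
proof -
  define r where "r = tensor_rank (set I) (set J) (set K) T"
  obtain u v w where T: "\<And>i j k. i \<in> set I \<Longrightarrow> j \<in> set J \<Longrightarrow> k \<in> set K \<Longrightarrow>
      T i j k = (\<Sum>s<r. u s i * v s j * w s k)"
    by (rule tensor_rankE[of "set I" "set J" "set K" T, folded r_def]) (auto intro: that)
  define g where "g u i a = (case a of Leaf s \<Rightarrow> [:u s i:] | _ \<Rightarrow> 0)" for u :: "nat \<Rightarrow> idx \<Rightarrow> 'a" and i a
  show ?thesis unfolding raw_unit_def r_def[symmetric]
  proof (rule degeneratesI[where \<alpha> = "g u" and \<beta> = "g v" and \<gamma> = "g w"])
    fix i j k assume ijk: "i \<in> set I" "j \<in> set J" "k \<in> set K"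
    have "(\<Sum>a<r. \<Sum>b<r. \<Sum>c<r. g u i (Leaf a) * g v j (Leaf b) * g w k (Leaf c) *
        [:if Leaf a = Leaf b \<and> Leaf b = Leaf c then 1 else 0:])
      = (\<Sum>a<r. \<Sum>b<r. \<Sum>c<r. (if c = b then 1 else 0) * ((if b = a then 1 else 0) * ([:u a i:] * [:v b j:] * [:w c k:])))"
      by (intro sum.cong refl) (auto simp: g_def)
    also have "\<dots> = (\<Sum>a<r. \<Sum>b<r. (if b = a then 1 else 0) * ([:u a i:] * [:v b j:] * [:w b k:]))"
      by (intro sum.cong refl sum_indicator_mult) auto
    also have "\<dots> = (\<Sum>a<r. [:u a i:] * [:v a j:] * [:w a k:])"
      by (intro sum.cong refl sum_indicator_mult) auto
    also have "\<dots> = [:T i j k:]" by (simp add: T ijk const_poly_sum mult_ac)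
    finally show "\<exists>q. (\<Sum>a\<in>set (map Leaf [0..<r]). \<Sum>b\<in>set (map Leaf [0..<r]). \<Sum>c\<in>set (map Leaf [0..<r]).
        g u i a * g v j b * g w k c * [:if a = b \<and> b = c then 1 else 0:]) =
        monom 1 0 * ([:T i j k:] + [:0, 1:] * q)"
      unfolding sum_Leaf by (intro exI[of _ 0]) simp
  qed
qed

lemma trank_mult_of_nat: "trank (x * y) \<le> trank (of_nat (trank x) * y)"
proof (cases x rule: tens_cases, cases y rule: tens_cases)
  fix I J K T I' J' K' T' assume x: "x = abs_tens (I, J, K, T)" and y: "y = abs_tens (I', J', K', T')"
  let ?r = "raw_unit (tensor_rank (set I) (set J) (set K) T)"
  have "degenerates (0 + 0) (raw_times (I, J, K, T) (I', J', K', T')) (raw_times ?r (I', J', K', T'))"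
    by (intro degenerates_times degenerates_unit degenerates_pullback pullback_refl)
  \<comment> \<open>Order 0 costs the factor (0 + 1)^2 = 1, so the inequality is exact, as the axiom
    of \<open>rank_semiring\<close> demands.\<close>
  from degenerates_rank[OF this] show ?thesis
    unfolding x y trank_abs of_nat_tens times_tens.abs_eq by simp
qed

interpretation tens: rank_semiring "trank :: 'a::field tens \<Rightarrow> nat"
  by unfold_locales (rule trank_add trank_le_add trank_of_nat trank_mult_of_nat)+

primrec raw_power :: "'a::field raw \<Rightarrow> nat \<Rightarrow> 'a raw" where
  "raw_power x 0 = ([Leaf 0], [Leaf 0], [Leaf 0], \<lambda>_ _ _. 1)"
| "raw_power x (Suc n) = raw_times x (raw_power x n)"

lemma abs_raw_power: "abs_tens (raw_power x n) = abs_tens x ^ n"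
  by (induction n) (simp_all add: one_tens.abs_eq times_tens.abs_eq[symmetric])

lemma degenerates_power:
  assumes "degenerates h x y"
  shows "degenerates (h * n) (raw_power x n) (raw_power y n)"
proof (induction n)
  case (Suc n)
  then show ?case using degenerates_times[OF assms Suc] by simp
qed (simp add: degenerates_pullback pullback_refl)

text \<open>The n-th power of a degeneration of order h has order h * n. Extracting its leading
  coefficient thus costs a factor quadratic in n, which the asymptotic preorder ignores. The test
  element z takes part by a degeneration of order 0.\<close>

lemma degenerates_asymp_le:
  fixes x y :: "'a::field raw"
  assumes "degenerates h x y"
  shows "tens.asymp_le (abs_tens x) (abs_tens y)"
proof (rule tens.asymp_leI[where c = "(h + 1)\<^sup>2" and k = 2])
  fix n and z :: "'a tens"
  obtain z' where z: "z = abs_tens z'" by (rule tens_cases[of z])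
  have "degenerates (h * n + 0) (raw_times (raw_power x n) z') (raw_times (raw_power y n) z')"
    by (intro degenerates_times degenerates_power degenerates_pullback pullback_refl assms)
  from degenerates_rank[OF this]
  have "trank (abs_tens x ^ n * z) \<le> (h * n + 1)\<^sup>2 * trank (abs_tens y ^ n * z)"
    by (simp add: z times_tens.abs_eq[symmetric] abs_raw_power)
  also have "h * n + 1 \<le> (h + 1) * (n + 1)" by simp
  then have "(h * n + 1)\<^sup>2 \<le> (h + 1)\<^sup>2 * (n + 1)\<^sup>2" by (simp only: power_mono zero_le flip: power_mult_distrib)
  finally show "trank (abs_tens x ^ n * z) \<le> (h + 1)\<^sup>2 * (n + 1)\<^sup>2 * trank (abs_tens y ^ n * z)"
    by simp
qed

section \<open>Kronecker powers and matrix multiplication in the semiring\<close>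

fun unleaf :: "idx \<Rightarrow> nat" where
  "unleaf (Leaf i) = i"
| "unleaf _ = 0"

definition leaves :: "nat \<Rightarrow> idx list" where
  "leaves n = map Leaf [0..<n]"

lemma in_leaves_iff: "x \<in> set (leaves n) \<longleftrightarrow> (\<exists>i<n. x = Leaf i)"
  by (auto simp: leaves_def)

lemma card_leaves: "card (set (leaves n)) = n"
  by (simp add: leaves_def card_image inj_on_def)

definition raw_tensor :: "nat \<Rightarrow> (nat, nat, nat, 'a::field) tensor \<Rightarrow> 'a raw" where
  "raw_tensor d T = (leaves d, leaves d, leaves d, \<lambda>i j k. T (unleaf i) (unleaf j) (unleaf k))"

primrec encode_tuple :: "nat \<Rightarrow> (nat \<Rightarrow> nat) \<Rightarrow> idx" where
  "encode_tuple 0 f = Leaf 0"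
| "encode_tuple (Suc n) f = Pr (Leaf (f n)) (encode_tuple n f)"

text \<open>The default \<open>undefined\<close> makes decoded tuples extensional, so that they lie
  in the function spaces that index the Kronecker power.\<close>

primrec decode_tuple :: "nat \<Rightarrow> idx \<Rightarrow> nat \<Rightarrow> nat" where
  "decode_tuple 0 x = (\<lambda>_. undefined)"
| "decode_tuple (Suc n) x = (case x of Pr a r \<Rightarrow> (decode_tuple n r)(n := unleaf a) | _ \<Rightarrow> (\<lambda>_. undefined))"

primrec tuples :: "nat \<Rightarrow> nat \<Rightarrow> idx list" where
  "tuples d 0 = [Leaf 0]"
| "tuples d (Suc n) = pairs (leaves d) (tuples d n)"

primrec power_array :: "(nat, nat, nat, 'a::field) tensor \<Rightarrow> nat \<Rightarrow> idx \<Rightarrow> idx \<Rightarrow> idx \<Rightarrow> 'a" where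
  "power_array T 0 = (\<lambda>_ _ _. 1)"
| "power_array T (Suc n) = times_array (\<lambda>i j k. T (unleaf i) (unleaf j) (unleaf k)) (power_array T n)"

lemma raw_power_tensor:
  "raw_power (raw_tensor d T) n = (tuples d n, tuples d n, tuples d n, power_array T n)"
  by (induction n) (simp_all add: raw_tensor_def raw_times_def)

lemma encode_tuple_in: "(\<And>t. t < n \<Longrightarrow> f t < d) \<Longrightarrow> encode_tuple n f \<in> set (tuples d n)"
  by (induction n) (auto simp: in_leaves_iff)

lemma power_array_encode:
  "power_array T n (encode_tuple n f) (encode_tuple n g) (encode_tuple n h) = tensor_power T n f g h"
  by (induction n) (simp_all add: tensor_power_def mult.commute)

lemma encode_tuple_cong: "(\<And>t. t < n \<Longrightarrow> f t = g t) \<Longrightarrow> encode_tuple n f = encode_tuple n g"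
  by (induction n) auto

lemma decode_tuple:
  assumes "x \<in> set (tuples d n)"
  shows "decode_tuple n x \<in> {..<n} \<rightarrow>\<^sub>E {..<d}" "encode_tuple n (decode_tuple n x) = x"
proof -
  have "decode_tuple n x \<in> {..<n} \<rightarrow>\<^sub>E {..<d} \<and> encode_tuple n (decode_tuple n x) = x"
    using assms
  proof (induction n arbitrary: x)
    case (Suc n)
    then obtain i r where x: "x = Pr (Leaf i) r" "i < d" "r \<in> set (tuples d n)"
      by (auto simp: in_leaves_iff elim!: in_pairsE)
    have "decode_tuple n r \<in> {..<n} \<rightarrow>\<^sub>E {..<d}" and r: "encode_tuple n (decode_tuple n r) = r"
      using Suc.IH[OF x(3)] by auto
    then have "(decode_tuple n r)(n := i) \<in> {..<Suc n} \<rightarrow>\<^sub>E {..<d}"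
      using x(2) by (fastforce simp: PiE_iff extensional_def less_Suc_eq)
    moreover have "encode_tuple n ((decode_tuple n r)(n := i)) = encode_tuple n (decode_tuple n r)"
      by (rule encode_tuple_cong) simp
    ultimately show ?case by (simp add: x r fun_upd_def)
  qed auto
  then show "decode_tuple n x \<in> {..<n} \<rightarrow>\<^sub>E {..<d}" "encode_tuple n (decode_tuple n x) = x"
    by auto
qed

lemma tensor_rank_power:
  "tensor_rank ({..<n} \<rightarrow>\<^sub>E {..<d}) ({..<n} \<rightarrow>\<^sub>E {..<d}) ({..<n} \<rightarrow>\<^sub>E {..<d}) (tensor_power T n)
     = trank (abs_tens (raw_tensor d T) ^ n)" (is "?l = _")
proof -
  let ?I = "{..<n} \<rightarrow>\<^sub>E {..<d}" and ?I' = "set (tuples d n)"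
  have fin: "finite ?I" by (simp add: finite_PiE)
  have "?l \<le> tensor_rank ?I' ?I' ?I' (power_array T n)"
    by (rule tensor_rank_pullback[where \<phi> = "encode_tuple n" and \<psi> = "encode_tuple n" and \<chi> = "encode_tuple n"])
      (auto simp: power_array_encode intro!: encode_tuple_in)
  moreover have "tensor_rank ?I' ?I' ?I' (power_array T n) \<le> ?l"
  proof (rule tensor_rank_pullback[where \<phi> = "decode_tuple n" and \<psi> = "decode_tuple n" and \<chi> = "decode_tuple n"])
    fix i j k assume "i \<in> ?I'" "j \<in> ?I'" "k \<in> ?I'"
    then show "power_array T n i j k = tensor_power T n (decode_tuple n i) (decode_tuple n j) (decode_tuple n k)"
      by (metis power_array_encode decode_tuple(2))
  qed (use fin decode_tuple(1) in auto)
  ultimately show ?thesis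
    by (simp flip: abs_raw_power add: raw_power_tensor trank_abs)
qed

lemma asymptotic_rank_eq:
  "asymptotic_rank {..<d} {..<d} {..<d} T = tens.F (abs_tens (raw_tensor d T))"
  by (simp add: asymptotic_rank_def tens.F_def tensor_rank_power)

section \<open>Matrix multiplication tensors\<close>

definition matmul_array :: "idx \<Rightarrow> idx \<Rightarrow> idx \<Rightarrow> 'a::field" where
  "matmul_array x y z = (case (x, y, z) of
     (Pr i j, Pr j' k, Pr k' i') \<Rightarrow> if i = i' \<and> j = j' \<and> k = k' then 1 else 0 | _ \<Rightarrow> 0)"

lemma matmul_array_simp [simp]:
  "matmul_array (Pr i j) (Pr j' k) (Pr k' i') = (if i = i' \<and> j = j' \<and> k = k' then 1 else 0)"
  by (simp add: matmul_array_def)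

text \<open>Arbitrary index lists are allowed because products of formats and the d by d^2 matrices
  of the square come indexed by pairs; \<open>abs_raw_matmul\<close> afterwards reduces everything
  to cardinalities.\<close>

definition raw_matmul :: "idx list \<Rightarrow> idx list \<Rightarrow> idx list \<Rightarrow> 'a::field raw" where
  "raw_matmul A B C = (pairs A B, pairs B C, pairs C A, matmul_array)"

lemma pullback_matmul:
  assumes "card (set A) \<le> card (set A')" "card (set B) \<le> card (set B')" "card (set C) \<le> card (set C')"
  shows "pullback (raw_matmul A B C) (raw_matmul A' B' C')"
proof -
  obtain f g h where fgh: "f ` set A \<subseteq> set A'" "inj_on f (set A)" "g ` set B \<subseteq> set B'" "inj_on g (set B)"
    "h ` set C \<subseteq> set C'" "inj_on h (set C)"
    using card_le_inj[OF finite_set finite_set] assms by metis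
  show ?thesis unfolding raw_matmul_def
  proof (rule pullbackI3[where \<phi> = "map_Pr f g" and \<psi> = "map_Pr g h" and \<chi> = "map_Pr h f"])
    fix i j k assume "i \<in> set (pairs A B)" "j \<in> set (pairs B C)" "k \<in> set (pairs C A)"
    then show "matmul_array i j k = matmul_array (map_Pr f g i) (map_Pr g h j) (map_Pr h f k)"
      using fgh by (elim in_pairsE) (simp add: inj_on_eq_iff)
  qed (use fgh in \<open>auto simp: image_subset_iff elim!: in_pairsE\<close>)
qed

definition MM :: "nat \<Rightarrow> nat \<Rightarrow> nat \<Rightarrow> 'a::field tens" where
  "MM n m p = abs_tens (raw_matmul (leaves n) (leaves m) (leaves p))"

lemma abs_raw_matmul: "abs_tens (raw_matmul A B C) = MM (card (set A)) (card (set B)) (card (set C))"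
  unfolding MM_def by (rule abs_tens_eqI; rule pullback_matmul) (simp_all add: card_leaves)

fun interchange_idx :: "idx \<Rightarrow> idx" where
  "interchange_idx (Pr (Pr a b) (Pr c d)) = Pr (Pr a c) (Pr b d)"
| "interchange_idx x = x"

lemma MM_mult: "MM n m p * MM n' m' p' = MM (n * n') (m * m') (p * p')"
proof -
  let ?N = "leaves n" and ?M = "leaves m" and ?P = "leaves p"
  let ?N' = "leaves n'" and ?M' = "leaves m'" and ?P' = "leaves p'"
  have "MM n m p * MM n' m' p' = abs_tens (raw_times (raw_matmul ?N ?M ?P) (raw_matmul ?N' ?M' ?P'))"
    by (simp add: MM_def times_tens.abs_eq)
  also have "\<dots> = abs_tens (raw_matmul (pairs ?N ?N') (pairs ?M ?M') (pairs ?P ?P'))"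
    unfolding raw_matmul_def raw_times_def prod.case
    by (rule abs_tens_eqI; rule pullbackI[where \<phi> = interchange_idx]; elim in_pairsE; force)
  also have "\<dots> = MM (n * n') (m * m') (p * p')"
    by (simp add: abs_raw_matmul card_pairs card_leaves)
  finally show ?thesis .
qed

lemma MM_one: "MM 1 1 1 = 1"
  unfolding MM_def one_tens.abs_eq raw_matmul_def
proof (rule abs_tens_eqI)
  show "pullback (pairs (leaves 1) (leaves 1), pairs (leaves 1) (leaves 1), pairs (leaves 1) (leaves 1),
      matmul_array) ([Leaf 0], [Leaf 0], [Leaf 0], \<lambda>_ _ _. 1 :: 'a)"
    by (rule pullbackI[where \<phi> = "\<lambda>_. Leaf 0"]; elim in_pairsE) (auto simp: in_leaves_iff)
  show "pullback ([Leaf 0], [Leaf 0], [Leaf 0], \<lambda>_ _ _. 1 :: 'a)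
      (pairs (leaves 1) (leaves 1), pairs (leaves 1) (leaves 1), pairs (leaves 1) (leaves 1), matmul_array)"
    by (rule pullbackI[where \<phi> = "\<lambda>_. Pr (Leaf 0) (Leaf 0)"]) (auto simp: in_leaves_iff)
qed

lemma MM_power: "MM n m p ^ k = MM (n ^ k) (m ^ k) (p ^ k)"
  by (induction k) (simp_all add: MM_mult flip: MM_one)

lemma MM_mono:
  assumes "n \<le> n'" "m \<le> m'" "p \<le> p'"
  shows "tens.asymp_le (MM n m p) (MM n' m' p')"
  unfolding MM_def
  by (intro degenerates_asymp_le[of 0] degenerates_pullback pullback_matmul) (simp_all add: card_leaves assms)

lemma one_le_MM:
  assumes "n > 0" "m > 0" "p > 0"
  shows "tens.asymp_le 1 (MM n m p)"
  using MM_mono[of 1 n 1 m 1 p] assms by (simp only: MM_one) (simp add: Suc_le_eq)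

lemma trank_MM: "trank (MM n m p :: 'a::field tens) = matmul_rank TYPE('a) n m p"
  unfolding matmul_rank_def MM_def raw_matmul_def trank_abs
proof (rule antisym)
  let ?f = "\<lambda>x. case x of Pr a b \<Rightarrow> (unleaf a, unleaf b) | _ \<Rightarrow> (0, 0)"
  show "tensor_rank (set (pairs (leaves n) (leaves m))) (set (pairs (leaves m) (leaves p)))
      (set (pairs (leaves p) (leaves n))) (matmul_array :: _ \<Rightarrow> _ \<Rightarrow> _ \<Rightarrow> 'a)
    \<le> tensor_rank ({..<n} \<times> {..<m}) ({..<m} \<times> {..<p}) ({..<p} \<times> {..<n}) (matmul_tensor :: (_, _, _, 'a) tensor)"
    by (rule tensor_rank_pullback[where \<phi> = ?f and \<psi> = ?f and \<chi> = ?f])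
      (auto simp: matmul_tensor_def in_leaves_iff elim!: in_pairsE)
  let ?g = "\<lambda>(a, b). Pr (Leaf a) (Leaf b)"
  show "tensor_rank ({..<n} \<times> {..<m}) ({..<m} \<times> {..<p}) ({..<p} \<times> {..<n}) (matmul_tensor :: (_, _, _, 'a) tensor)
    \<le> tensor_rank (set (pairs (leaves n) (leaves m))) (set (pairs (leaves m) (leaves p)))
      (set (pairs (leaves p) (leaves n))) (matmul_array :: _ \<Rightarrow> _ \<Rightarrow> _ \<Rightarrow> 'a)"
    by (rule tensor_rank_pullback[where \<phi> = ?g and \<psi> = ?g and \<chi> = ?g])
      (auto simp: matmul_tensor_def in_leaves_iff)
qed

text \<open>The flattening along the first factor is injective: the entry at (i, j) is detected by
  the indices (j, 0) and (0, i). The fixed index 0 exists once n is positive.\<close>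

lemma matmul_rank_ge: "n ^ 2 \<le> matmul_rank TYPE('a::field) n n n"
proof (cases "n = 0")
  case False
  have "card ({..<n} \<times> {..<n}) \<le> matmul_rank TYPE('a) n n n"
    unfolding matmul_rank_def
    by (rule tensor_rank_ge_card[where \<psi> = "\<lambda>(i, j). (j, 0)" and \<chi> = "\<lambda>(i, j). (0, i)"])
      (use False in \<open>auto simp: matmul_tensor_def split: if_splits\<close>)
  then show ?thesis by (simp add: power2_eq_square)
qed simp

text \<open>A crude bound that makes the set of admissible exponents nonempty, so that lower bounds
  pass to its infimum.\<close>

lemma matmul_rank_le: "matmul_rank TYPE('a::field) n n n \<le> n ^ 6"
proof -
  have "matmul_rank TYPE('a) n n n \<le> card ({..<n} \<times> {..<n}) * card ({..<n} \<times> {..<n}) * card ({..<n} \<times> {..<n})"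
    unfolding matmul_rank_def by (rule tensor_rank_le_card) auto
  then show ?thesis by (simp add: eval_nat_numeral mult.assoc)
qed

section \<open>Cyclic rotation of the three factors\<close>

lift_definition rotate :: "'a::field tens \<Rightarrow> 'a tens" is "\<lambda>(I, J, K, T). (J, K, I, \<lambda>j k i. T i j k)"
proof -
  have "pullback (case x of (I, J, K, T) \<Rightarrow> (J, K, I, \<lambda>j k i. T i j k)) (case y of (I, J, K, T) \<Rightarrow> (J, K, I, \<lambda>j k i. T i j k))"
    if xy: "pullback x y" for x y :: "'a raw"
    using xy
  proof (rule pullbackE)
    fix I J K T I' J' K' T' \<phi> \<psi> \<chi>
    assume x: "x = (I, J, K, T)" "y = (I', J', K', T')"
      and 1: "\<And>i. i \<in> set I \<Longrightarrow> \<phi> i \<in> set I'" "\<And>j. j \<in> set J \<Longrightarrow> \<psi> j \<in> set J'"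
      "\<And>k. k \<in> set K \<Longrightarrow> \<chi> k \<in> set K'"
      "\<And>i j k. i \<in> set I \<Longrightarrow> j \<in> set J \<Longrightarrow> k \<in> set K \<Longrightarrow> T i j k = T' (\<phi> i) (\<psi> j) (\<chi> k)"
    show ?thesis unfolding x prod.case
      by (rule pullbackI3[where \<phi> = \<psi> and \<psi> = \<chi> and \<chi> = \<phi>]) (simp_all add: 1)
  qed
  then show "\<And>x y :: 'a raw. equivalent x y \<Longrightarrow> equivalent
      (case x of (I, J, K, T) \<Rightarrow> (J, K, I, \<lambda>j k i. T i j k)) (case y of (I, J, K, T) \<Rightarrow> (J, K, I, \<lambda>j k i. T i j k))"
    by (simp add: equivalent_def)
qed

lemma rotate_abs: "rotate (abs_tens (I, J, K, T)) = abs_tens (J, K, I, \<lambda>j k i. T i j k)"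
  by (simp add: rotate.abs_eq)

lemma rotate_plus: "rotate (x + y) = rotate x + rotate y"
proof (cases x rule: tens_cases, cases y rule: tens_cases)
  fix I J K T I' J' K' T' assume x: "x = abs_tens (I, J, K, T)" and y: "y = abs_tens (I', J', K', T')"
  show ?thesis unfolding x y plus_tens.abs_eq raw_plus_def prod.case rotate_abs
    by (rule abs_tens_eqI; rule pullbackI[where \<phi> = id]) (auto elim!: in_summandsE)
qed

lemma rotate_times: "rotate (x * y) = rotate x * rotate y"
proof (cases x rule: tens_cases, cases y rule: tens_cases)
  fix I J K T I' J' K' T' assume x: "x = abs_tens (I, J, K, T)" and y: "y = abs_tens (I', J', K', T')"
  show ?thesis unfolding x y times_tens.abs_eq raw_times_def prod.case rotate_abs
    by (rule abs_tens_eqI; rule pullbackI[where \<phi> = id]) (auto elim!: in_pairsE)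
qed

lemma rotate_one: "rotate 1 = 1"
  by (simp add: one_tens.abs_eq rotate_abs)

lemma rotate_power: "rotate (x ^ n) = rotate x ^ n"
  by (induction n) (simp_all add: rotate_one rotate_times)

lemma rotate_rotate_rotate: "rotate (rotate (rotate x)) = x"
  by (cases x rule: tens_cases) (simp add: rotate_abs)

lemma rotate_MM: "rotate (MM n m p) = MM m p n"
  unfolding MM_def raw_matmul_def rotate_abs
  by (rule abs_tens_eqI; rule pullbackI[where \<phi> = id]) (auto elim!: in_pairsE)

lemma trank_rotate: "trank (rotate x) = trank x"
proof -
  have le: "trank (rotate x) \<le> trank x" for x :: "'a tens"
  proof (cases x rule: tens_cases)
    fix I J K T assume x: "x = abs_tens (I, J, K, T)"
    obtain u v w where uvw: "\<And>i j k. i \<in> set I \<Longrightarrow> j \<in> set J \<Longrightarrow> k \<in> set K \<Longrightarrow>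
      T i j k = (\<Sum>s<trank x. u s i * v s j * w s k)"
      unfolding x trank_abs by (rule tensor_rankE[of "set I" "set J" "set K" T]) (auto intro: that)
    have "tensor_rank (set J) (set K) (set I) (\<lambda>j k i. T i j k) \<le> card {..<trank x}"
      by (rule tensor_rank_leI[where u = v and v = w and w = u]) (simp_all add: uvw mult_ac)
    then show "trank (rotate x) \<le> trank x" by (simp add: x rotate_abs trank_abs)
  qed
  show ?thesis using le[of x] le[of "rotate x"] le[of "rotate (rotate x)"]
    by (simp add: rotate_rotate_rotate)
qed

lemma F_rotate: "tens.F (rotate x) = tens.F x"
  by (simp add: tens.F_def trank_rotate flip: rotate_power)

text \<open>Rotation is a semiring automorphism of order three that preserves rank, so it can be
  moved from x to the test element z as its inverse.\<close>

lemma asymp_le_rotate: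
  assumes "tens.asymp_le x y"
  shows "tens.asymp_le (rotate x) (rotate y)"
  unfolding tens.asymp_le_def
proof
  fix z :: "'a tens"
  have z: "z = rotate (rotate (rotate z))" by (simp add: rotate_rotate_rotate)
  have "tens.F (rotate w * z) = tens.F (w * rotate (rotate z))" for w
    by (subst z) (simp add: F_rotate flip: rotate_times)
  then show "tens.F (rotate x * z) \<le> tens.F (rotate y * z)"
    using assms unfolding tens.asymp_le_def by simp
qed

text \<open>A nonzero entry, isolated by coordinate projections and rescaled by its inverse,
  exhibits 1 as a restriction. This puts 1 below every nonzero tensor, as smoothing and
  superadditivity require.\<close>

lemma degenerates_nonzero:
  fixes T :: "idx \<Rightarrow> idx \<Rightarrow> idx \<Rightarrow> 'a::field"
  assumes "i0 \<in> set I" "j0 \<in> set J" "k0 \<in> set K" "T i0 j0 k0 \<noteq> 0"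
  shows "degenerates 0 ([Leaf 0], [Leaf 0], [Leaf 0], \<lambda>_ _ _. 1) (I, J, K, T)"
proof (rule degeneratesI[where \<alpha> = "\<lambda>_ i. if i = i0 then 1 else 0" and \<beta> = "\<lambda>_ i. if i = j0 then 1 else 0"
    and \<gamma> = "\<lambda>_ i. (if i = k0 then 1 else 0) * [:1 / T i0 j0 k0:]"])
  have "(\<Sum>a\<in>set I. \<Sum>b\<in>set J. \<Sum>c\<in>set K. (if a = i0 then 1 else 0) * (if b = j0 then 1 else 0) *
      ((if c = k0 then 1 else 0) * [:1 / T i0 j0 k0:]) * [:T a b c:]) = [:1 / T i0 j0 k0:] * [:T i0 j0 k0:]"
    by (simp only: mult.assoc sum_distrib_left[symmetric] sum_indicator_mult finite_set assms)
  then show "\<exists>q. (\<Sum>a\<in>set I. \<Sum>b\<in>set J. \<Sum>c\<in>set K. (if a = i0 then 1 else 0) * (if b = j0 then 1 else 0) *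
      ((if c = k0 then 1 else 0) * [:1 / T i0 j0 k0:]) * [:T a b c:]) = monom 1 0 * ([:1:] + [:0, 1:] * q)"
    using assms(4) by (intro exI[of _ 0]) (simp flip: one_pCons)
qed

section \<open>Degeneration of the square of a tensor\<close>

text \<open>Gaussian elimination, one constraint at a time, starting with the standard basis for
  both families. If a constraint fails at \<open>l0\<close>, this index is given up and multiples of
  \<open>V l0\<close> correct the remaining \<open>V l\<close>. The duals \<open>U l\<close> stay
  unchanged, because they already vanish on \<open>V l0\<close> for l different from
  \<open>l0\<close>. Each constraint costs at most one index.\<close>

lemma dual_orthogonal_families:
  fixes X :: "'q \<Rightarrow> 'p \<Rightarrow> 'a::field"
  assumes "finite P" "finite Q"
  shows "\<exists>L U V. L \<subseteq> P \<and> card P \<le> card L + card Q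
    \<and> (\<forall>m\<in>Q. \<forall>l\<in>L. (\<Sum>c\<in>P. X m c * V l c) = 0)
    \<and> (\<forall>l\<in>L. \<forall>l'\<in>L. (\<Sum>c\<in>P. U l c * V l' c) = (if l = l' then 1 else 0 :: 'a))"
  using assms(2)
proof (induction Q rule: finite_induct)
  case empty
  let ?e = "\<lambda>l c. if c = l then 1 else 0 :: 'a"
  have "\<forall>l\<in>P. \<forall>l'\<in>P. (\<Sum>c\<in>P. ?e l c * ?e l' c) = (if l = l' then 1 else 0)"
    using assms(1) by (auto simp: sum_indicator_mult)
  then show ?case by (intro exI[of _ P] exI[of _ ?e]) simp
next
  case (insert m Q)
  then obtain L :: "'p set" and U V :: "'p \<Rightarrow> 'p \<Rightarrow> 'a" where L: "L \<subseteq> P" "card P \<le> card L + card Q"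
    and orth: "\<And>m l. m \<in> Q \<Longrightarrow> l \<in> L \<Longrightarrow> (\<Sum>c\<in>P. X m c * V l c) = 0"
    and dual: "\<And>l l'. l \<in> L \<Longrightarrow> l' \<in> L \<Longrightarrow> (\<Sum>c\<in>P. U l c * V l' c) = (if l = l' then 1 else 0 :: 'a)"
    by blast
  define z where "z l = (\<Sum>c\<in>P. X m c * V l c)" for l
  show ?case
  proof (cases "\<forall>l\<in>L. z l = 0")
    case True
    then show ?thesis
      by (intro exI[of _ L] exI[of _ U] exI[of _ V]) (use L orth dual insert in \<open>auto simp: z_def\<close>)
  next
    case False
    then obtain l0 where l0: "l0 \<in> L" "z l0 \<noteq> 0" by blast
    define V' where "V' l c = V l c - z l / z l0 * V l0 c" for l c
    have V': "(\<Sum>c\<in>P. f c * V' l c) = (\<Sum>c\<in>P. f c * V l c) - z l / z l0 * (\<Sum>c\<in>P. f c * V l0 c)" for f l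
      by (simp add: V'_def right_diff_distrib sum_subtractf sum_distrib_left mult.left_commute)
    have "finite L" using L(1) assms(1) finite_subset by blast
    then have card: "card P \<le> card (L - {l0}) + card (insert m Q)"
      using L(2) l0(1) insert by (cases "card L") auto
    have "(\<Sum>c\<in>P. X m' c * V' l c) = 0" if "m' \<in> insert m Q" "l \<in> L - {l0}" for m' l
    proof (cases "m' = m")
      case True
      have "(\<Sum>c\<in>P. X m' c * V' l c) = z l - z l / z l0 * z l0"
        unfolding V' True z_def ..
      then show ?thesis using l0 by simp
    next
      case False
      then show ?thesis using that orth l0 by (simp add: V')
    qed
    moreover have "(\<Sum>c\<in>P. U l c * V' l' c) = (if l = l' then 1 else 0)"
      if "l \<in> L - {l0}" "l' \<in> L - {l0}" for l l'
      using that dual l0 by (simp add: V')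
    ultimately show ?thesis
      by (intro exI[of _ "L - {l0}"] exI[of _ U] exI[of _ V']) (use L card in auto)
  qed
qed

text \<open>The array leaves one free index per matrix side, so a contraction with three families is
  the trace of a product of three matrices.\<close>

lemma sum_matmul:
  fixes f g h :: "idx \<Rightarrow> 'a::field poly"
  shows "(\<Sum>x\<in>set (pairs A B). \<Sum>y\<in>set (pairs B C). \<Sum>z\<in>set (pairs C A). f x * g y * h z * [:matmul_array x y z:])
    = (\<Sum>i\<in>set A. \<Sum>j\<in>set B. \<Sum>k\<in>set C. f (Pr i j) * g (Pr j k) * h (Pr k i))"
proof -
  have "(\<Sum>x\<in>set (pairs A B). \<Sum>y\<in>set (pairs B C). \<Sum>z\<in>set (pairs C A). f x * g y * h z * [:matmul_array x y z:])
    = (\<Sum>i\<in>set A. \<Sum>j\<in>set B. \<Sum>j'\<in>set B. \<Sum>k\<in>set C. \<Sum>k'\<in>set C. \<Sum>i'\<in>set A.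
        (if i' = i then 1 else 0) * ((if k' = k then 1 else 0) * ((if j' = j then 1 else 0) *
          (f (Pr i j) * g (Pr j' k) * h (Pr k' i')))))"
    unfolding sum_pairs by (intro sum.cong refl) auto
  also have "\<dots> = (\<Sum>i\<in>set A. \<Sum>j\<in>set B. \<Sum>j'\<in>set B. \<Sum>k\<in>set C. \<Sum>k'\<in>set C.
        (if k' = k then 1 else 0) * ((if j' = j then 1 else 0) *
          (f (Pr i j) * g (Pr j' k) * h (Pr k' i))))"
    by (intro sum.cong refl sum_indicator_mult) auto
  also have "\<dots> = (\<Sum>i\<in>set A. \<Sum>j\<in>set B. \<Sum>j'\<in>set B. \<Sum>k\<in>set C.
        (if j' = j then 1 else 0) * (f (Pr i j) * g (Pr j' k) * h (Pr k i)))"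
    by (intro sum.cong refl sum_indicator_mult) auto
  also have "\<dots> = (\<Sum>i\<in>set A. \<Sum>j\<in>set B. \<Sum>j'\<in>set B.
        (if j' = j then 1 else 0) * (\<Sum>k\<in>set C. f (Pr i j) * g (Pr j' k) * h (Pr k i)))"
    by (simp only: sum_distrib_left)
  also have "\<dots> = (\<Sum>i\<in>set A. \<Sum>j\<in>set B. \<Sum>k\<in>set C. f (Pr i j) * g (Pr j k) * h (Pr k i))"
    by (intro sum.cong refl sum_indicator_mult) auto
  finally show ?thesis .
qed

text \<open>
  Contracting the two copies of \<open>T\<close> with the variables \<open>x\<close> and \<open>y\<close> gives matrices \<open>A\<^sub>x\<close> and \<open>B\<^sub>y\<close>
  such that the square of \<open>T\<close> is the trace of \<open>A\<^sub>x B\<^sub>y Z\<close>. The matrices \<open>A\<^sub>x\<close> form a space of dimension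
  at most \<open>card I ^ 2\<close>, so there are many directions \<open>V\<^sub>l\<close> orthogonal to it for the trace form, with
  dual directions \<open>U\<^sub>l\<close>. Substituting \<open>A\<^sub>x + \<epsilon> \<Sum> u\<^sub>l U\<^sub>l\<close>, \<open>B\<^sub>y + \<epsilon> \<Sum> v\<^sub>l V\<^sub>l\<close> and \<open>\<epsilon>\<^sup>2 Z + w Id\<close>, the trace is
  \<open>\<epsilon>\<^sup>2\<close> times the square of \<open>T\<close> plus \<open>w \<Sum> u\<^sub>l v\<^sub>l\<close>, up to higher order terms and a multiple of \<open>w\<close> that
  is a bilinear form in \<open>(x, u)\<close> and \<open>y\<close>. That form is cancelled by the second matrix multiplication tensor.
\<close>

lemma degenerates_square:
  fixes T :: "idx \<Rightarrow> idx \<Rightarrow> idx \<Rightarrow> 'a::field"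
  obtains L where "card (set I) * card (set J) * card (set K) \<le> card (set L) + card (set I) ^ 2"
    and "degenerates 2
      (raw_plus (raw_times (I, J, K, T) (I, J, K, T)) (raw_matmul [Leaf 0] L [Leaf 0]))
      (raw_plus (raw_matmul K (pairs I J) K) (raw_matmul [Leaf 0] (pairs J J) [Leaf 0]))"
proof -
  \<comment> \<open>P indexes the entries of a matrix with rows K and columns I x J, so its size is
    the ambient dimension; the pairs in I x I are the linear constraints.\<close>
  define P where "P = pairs K (pairs I J)"
  define Q where "Q = pairs J J"
  \<comment> \<open>\<open>X (Pr i i0)\<close> is the matrix for the variable (i, i0): the first
    copy of T is contracted at i, and i0 selects the block of columns where the second copy will
    read its first index.\<close>
  define X :: "idx \<Rightarrow> idx \<Rightarrow> 'a" where "X m c = (case (m, c) of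
     (Pr i i0, Pr k (Pr i1 j)) \<Rightarrow> if i1 = i0 then T i j k else 0 | _ \<Rightarrow> 0)" for m c
  have X: "X (Pr i i0) (Pr k (Pr i1 j)) = (if i1 = i0 then T i j k else 0)" for i i0 k i1 j
    by (simp add: X_def)
  obtain L0 U V where L0: "L0 \<subseteq> set P" "card (set P) \<le> card L0 + card (set (pairs I I))"
    and orth: "\<And>m l. m \<in> set (pairs I I) \<Longrightarrow> l \<in> L0 \<Longrightarrow> (\<Sum>c\<in>set P. X m c * V l c) = 0"
    and dual: "\<And>l l'. l \<in> L0 \<Longrightarrow> l' \<in> L0 \<Longrightarrow> (\<Sum>c\<in>set P. U l c * V l' c) = (if l = l' then 1 else 0 :: 'a)"
    using dual_orthogonal_families[OF finite_set finite_set, of P "pairs I I" X] by blast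
  obtain L where L: "set L = L0" using finite_list[OF finite_subset[OF L0(1) finite_set]] by blast
  define A :: "idx \<Rightarrow> idx \<Rightarrow> 'a poly" where "A x c = (case x of InL m \<Rightarrow> [:X m c:]
      | InR (Pr u l) \<Rightarrow> [:0, 1:] * [:U l c:] | _ \<Rightarrow> 0)" for x c
  \<comment> \<open>The second matrix is stored transposed, with entries indexed by P like those of
    A. The trace form is then the plain sum over P; \<beta> transposes it back.\<close>
  define B :: "idx \<Rightarrow> idx \<Rightarrow> 'a poly" where "B y c = (case y of
      InL (Pr j j') \<Rightarrow> (case c of Pr k' (Pr i0 j1) \<Rightarrow> [:if j1 = j then T i0 j' k' else 0:] | _ \<Rightarrow> 0)
      | InR (Pr l u) \<Rightarrow> [:0, 1:] * [:V l c:] | _ \<Rightarrow> 0)" for y c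
  have A: "A (InL m) c = [:X m c:]" "A (InR (Pr u l)) c = [:0, 1:] * [:U l c:]" for m c u l
    by (simp_all add: A_def)
  have B: "B (InL (Pr j j')) (Pr k' (Pr i0 j1)) = [:if j1 = j then T i0 j' k' else 0:]"
    "B (InR (Pr l u)) c = [:0, 1:] * [:V l c:]" for j j' k' i0 j1 u l c
    by (simp_all add: B_def)
  \<comment> \<open>In the second summand \<beta> picks the coordinate m of y, so an inner product
    over Q can reproduce any bilinear form in (x, u) and y; \<alpha> supplies the negative of the
    unwanted one. Q lists the variables y, whence the length card J squared.\<close>
  define \<alpha> :: "idx \<Rightarrow> idx \<Rightarrow> 'a poly" where "\<alpha> x a = (case a of InL c \<Rightarrow> A x c
      | InR (Pr u m) \<Rightarrow> - (\<Sum>c\<in>set P. A x c * B (InL m) c) | _ \<Rightarrow> 0)" for x a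
  define \<beta> :: "idx \<Rightarrow> idx \<Rightarrow> 'a poly" where "\<beta> y b = (case b of InL (Pr l k') \<Rightarrow> B y (Pr k' l)
      | InR (Pr m u) \<Rightarrow> (if y = InL m then 1 else 0) | _ \<Rightarrow> 0)" for y b
  define \<gamma> :: "idx \<Rightarrow> idx \<Rightarrow> 'a poly" where "\<gamma> z c = (case (z, c) of
      (InL (Pr k k'), InL (Pr k1' k1)) \<Rightarrow> (if k1 = k then 1 else 0) * ((if k1' = k' then 1 else 0) * monom 1 2)
      | (InR z', InL (Pr k1' k1)) \<Rightarrow> (if k1' = k1 then 1 else 0)
      | (InR z', InR c') \<Rightarrow> 1 | _ \<Rightarrow> 0)" for z c
  have \<alpha>: "\<alpha> x (InL c) = A x c" "\<alpha> x (InR (Pr u m)) = - (\<Sum>c\<in>set P. A x c * B (InL m) c)" for x c u m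
    by (simp_all add: \<alpha>_def)
  have \<beta>: "\<beta> y (InL (Pr l k')) = B y (Pr k' l)" "\<beta> y (InR (Pr m u)) = (if y = InL m then 1 else 0)" for y l k' m u
    by (simp_all add: \<beta>_def)
  have \<gamma>: "\<gamma> (InL (Pr k k')) (InL (Pr k1' k1)) = (if k1 = k then 1 else 0) * ((if k1' = k' then 1 else 0) * monom 1 2)"
    "\<gamma> (InR z') (InL (Pr k1' k1)) = (if k1' = k1 then 1 else 0)"
    "\<gamma> (InR z') (InR c') = 1" "\<gamma> (InL z') (InR c') = 0" for k k' k1 k1' z' c'
    by (simp_all add: \<gamma>_def split: idx.split)
  let ?a = "summands P (pairs [Leaf 0] Q)" and ?b = "summands (pairs (pairs I J) K) (pairs Q [Leaf 0])"
    and ?c = "summands (pairs K K) (pairs [Leaf 0] [Leaf 0])"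
  have split: "(\<Sum>a\<in>set ?a. \<Sum>b\<in>set ?b. \<Sum>c\<in>set ?c. \<alpha> x a * \<beta> y b * \<gamma> z c * [:plus_array matmul_array matmul_array a b c:])
    = (\<Sum>k\<in>set K. \<Sum>l\<in>set (pairs I J). \<Sum>k'\<in>set K. A x (Pr k l) * B y (Pr k' l) * \<gamma> z (InL (Pr k' k)))
    + (\<Sum>m\<in>set Q. \<alpha> x (InR (Pr (Leaf 0) m)) * \<beta> y (InR (Pr m (Leaf 0))) * \<gamma> z (InR (Pr (Leaf 0) (Leaf 0))))"
    (is "_ = ?S1 x y z + ?S2 x y z") for x y z
  proof -
    have "(\<Sum>a\<in>set ?a. \<Sum>b\<in>set ?b. \<Sum>c\<in>set ?c. \<alpha> x a * \<beta> y b * \<gamma> z c * [:plus_array matmul_array matmul_array a b c:])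
      = (\<Sum>a\<in>set (pairs K (pairs I J)). \<Sum>b\<in>set (pairs (pairs I J) K). \<Sum>c\<in>set (pairs K K).
          \<alpha> x (InL a) * \<beta> y (InL b) * \<gamma> z (InL c) * [:matmul_array a b c:])
      + (\<Sum>a\<in>set (pairs [Leaf 0] Q). \<Sum>b\<in>set (pairs Q [Leaf 0]). \<Sum>c\<in>set (pairs [Leaf 0] [Leaf 0]).
          \<alpha> x (InR a) * \<beta> y (InR b) * \<gamma> z (InR c) * [:matmul_array a b c:])"
      by (simp add: sum_summands P_def)
    then show ?thesis unfolding sum_matmul \<alpha>(1) \<beta>(1) by simp
  qed
  have S1_L: "?S1 x y (InL (Pr k k')) = monom 1 2 * (\<Sum>l\<in>set (pairs I J). A x (Pr k l) * B y (Pr k' l))"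
    if "k \<in> set K" "k' \<in> set K" for x y k k'
  proof -
    have "?S1 x y (InL (Pr k k')) = (\<Sum>k1\<in>set K. (if k1 = k then 1 else 0) * (\<Sum>l\<in>set (pairs I J). \<Sum>k1'\<in>set K.
        (if k1' = k' then 1 else 0) * (monom 1 2 * (A x (Pr k1 l) * B y (Pr k1' l)))))"
      unfolding \<gamma> sum_distrib_left by (intro sum.cong refl) (simp only: mult_ac)
    also have "\<dots> = monom 1 2 * (\<Sum>l\<in>set (pairs I J). A x (Pr k l) * B y (Pr k' l))"
      by (simp only: sum_indicator_mult finite_set that) (simp only: sum_distrib_left)
    finally show ?thesis .
  qed
  have S1_R: "?S1 x y (InR w) = (\<Sum>c\<in>set P. A x c * B y c)" for x y w
  proof -
    have "?S1 x y (InR w) = (\<Sum>k\<in>set K. \<Sum>l\<in>set (pairs I J). \<Sum>k'\<in>set K.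
        (if k' = k then 1 else 0) * (A x (Pr k l) * B y (Pr k' l)))"
      unfolding \<gamma> by (intro sum.cong refl) (simp only: mult_ac)
    also have "\<dots> = (\<Sum>k\<in>set K. \<Sum>l\<in>set (pairs I J). A x (Pr k l) * B y (Pr k l))"
      by (intro sum.cong refl sum_indicator_mult) auto
    finally show ?thesis unfolding P_def sum_pairs[of _ K] .
  qed
  have S2_L: "?S2 x y (InL w) = 0" for x y w by (simp add: \<gamma>)
  have S2_RL: "?S2 x (InL m) (InR w) = - (\<Sum>c\<in>set P. A x c * B (InL m) c)" if "m \<in> set Q" for x m w
  proof -
    have "?S2 x (InL m) (InR w) = (\<Sum>m'\<in>set Q. (if m' = m then 1 else 0) * (- (\<Sum>c\<in>set P. A x c * B (InL m') c)))"
      unfolding \<alpha> \<beta> \<gamma> by (intro sum.cong refl) auto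
    then show ?thesis using that by (simp only: sum_indicator_mult finite_set)
  qed
  have S2_RR: "?S2 x (InR m) (InR w) = 0" for x m w by (simp add: \<beta>)
  have deg: "degenerates 2
      (summands (pairs I I) (pairs [Leaf 0] L), summands (pairs J J) (pairs L [Leaf 0]),
        summands (pairs K K) (pairs [Leaf 0] [Leaf 0]), plus_array (times_array T T) matmul_array)
      (?a, ?b, ?c, plus_array matmul_array matmul_array)"
  proof (rule degeneratesI[where \<alpha> = \<alpha> and \<beta> = \<beta> and \<gamma> = \<gamma>], unfold split)
    fix x y z
    assume x: "x \<in> set (summands (pairs I I) (pairs [Leaf 0] L))"
      and y: "y \<in> set (summands (pairs J J) (pairs L [Leaf 0]))"
      and z: "z \<in> set (summands (pairs K K) (pairs [Leaf 0] [Leaf 0]))"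
    let ?G = "\<lambda>q. monom 1 2 * ([:plus_array (times_array T T) matmul_array x y z:] + [:0, 1:] * q)"
    show "\<exists>q. ?S1 x y z + ?S2 x y z = ?G q"
      using z
    proof (cases rule: in_summandsE)
      case (1 w)
      then obtain k k' where w: "z = InL (Pr k k')" "k \<in> set K" "k' \<in> set K"
        by (elim in_pairsE) auto
      have S: "?S1 x y z + ?S2 x y z = monom 1 2 * (\<Sum>l\<in>set (pairs I J). A x (Pr k l) * B y (Pr k' l))"
        using w by (simp only: S1_L S2_L add_0_right)
      show ?thesis
      proof (cases "(\<exists>m. x = InL m) \<and> (\<exists>m. y = InL m)")
        case True
        then obtain i i0 j j' where xy: "x = InL (Pr i i0)" "y = InL (Pr j j')"
          "i \<in> set I" "i0 \<in> set I" "j \<in> set J" "j' \<in> set J"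
          using x y by (auto elim!: in_pairsE)
        have "(\<Sum>l\<in>set (pairs I J). A x (Pr k l) * B y (Pr k' l)) =
            (\<Sum>i1\<in>set I. \<Sum>j1\<in>set J. (if i1 = i0 then 1 else 0) * ((if j1 = j then 1 else 0) *
              [:T i j1 k * T i1 j' k':]))"
          unfolding sum_pairs xy A B X by (intro sum.cong refl) auto
        also have "\<dots> = [:T i j k * T i0 j' k':]"
          by (simp only: sum_distrib_left[symmetric] sum_indicator_mult finite_set xy)
        finally have "?S1 x y z + ?S2 x y z = ?G 0" unfolding S by (simp add: xy w)
        then show ?thesis by blast
      next
        case False
        \<comment> \<open>If x or y is an additional direction, A or B already carries a factor of
          the variable. With the square contributed by \<gamma> the term lies beyond the leading
          order 2.\<close>
        have "\<exists>q. (\<Sum>l\<in>set (pairs I J). A x (Pr k l) * B y (Pr k' l)) = [:0, 1:] * q"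
        proof (cases "\<exists>m. x = InL m")
          case True
          with False y obtain l' where "y = InR (Pr l' (Leaf 0))"
            by (auto elim!: in_summandsE in_pairsE)
          then show ?thesis
            by (intro exI[of _ "\<Sum>l\<in>set (pairs I J). A x (Pr k l) * [:V l' (Pr k' l):]"])
              (simp only: B sum_distrib_left mult_ac)
        next
          case False
          with x obtain l' where "x = InR (Pr (Leaf 0) l')"
            by (auto elim!: in_summandsE in_pairsE)
          then show ?thesis
            by (intro exI[of _ "\<Sum>l\<in>set (pairs I J). [:U l' (Pr k l):] * B y (Pr k' l)"])
              (simp only: A sum_distrib_left mult_ac)
        qed
        moreover have "plus_array (times_array T T) matmul_array x y z = 0"
          using False x y w by (auto elim!: in_summandsE)
        ultimately show ?thesis unfolding S by auto
      qed
    next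
      case (2 w)
      have z0: "z = InR (Pr (Leaf 0) (Leaf 0))" using 2 by (auto elim!: in_pairsE)
      show ?thesis using y
      proof (cases rule: in_summandsE)
        case y1: (1 m)
        have "?S1 x y z + ?S2 x y z = 0"
          using y1 by (simp only: z0 S1_R S2_RL Q_def[symmetric] add.right_inverse)
        moreover have "plus_array (times_array T T) matmul_array x y z = 0"
          using x y1 z0 by (auto elim!: in_summandsE)
        ultimately show ?thesis by (intro exI[of _ 0]) simp
      next
        case y2: (2 m)
        then obtain l' where l': "y = InR (Pr l' (Leaf 0))" "l' \<in> L0" by (auto simp: L elim!: in_pairsE)
        have S: "?S1 x y z + ?S2 x y z = (\<Sum>c\<in>set P. A x c * B y c)"
          by (simp only: z0 l' S1_R S2_RR add_0_right)
        show ?thesis using x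
        proof (cases rule: in_summandsE)
          case x1: (1 m)
          have "(\<Sum>c\<in>set P. A x c * B y c) = [:0, 1:] * [:\<Sum>c\<in>set P. X m c * V l' c:]"
            unfolding const_poly_sum sum_distrib_left x1 l' A B
            by (intro sum.cong refl) (simp add: mult_ac)
          also have "\<dots> = 0" using orth[OF x1(2) l'(2)] by simp
          finally have "?S1 x y z + ?S2 x y z = 0" unfolding S .
          moreover have "plus_array (times_array T T) matmul_array x y z = 0" by (simp add: x1 l' z0)
          ultimately show ?thesis by (intro exI[of _ 0]) simp
        next
          case x2: (2 m)
          then obtain l where l: "x = InR (Pr (Leaf 0) l)" "l \<in> L0" by (auto simp: L elim!: in_pairsE)
          have "(\<Sum>c\<in>set P. A x c * B y c) = monom 1 2 * [:\<Sum>c\<in>set P. U l c * V l' c:]"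
            unfolding const_poly_sum sum_distrib_left l l' A B
            by (intro sum.cong refl) (simp add: monom_altdef power2_eq_square)
          also have "\<dots> = ?G 0" using dual[OF l(2) l'(2)] by (simp add: l l' z0)
          finally show ?thesis unfolding S by blast
        qed
      qed
    qed
  qed
  have "degenerates 2
      (raw_plus (raw_times (I, J, K, T) (I, J, K, T)) (raw_matmul [Leaf 0] L [Leaf 0]))
      (raw_plus (raw_matmul K (pairs I J) K) (raw_matmul [Leaf 0] (pairs J J) [Leaf 0]))"
    using deg unfolding raw_plus_def raw_times_def raw_matmul_def prod.case P_def Q_def .
  moreover have "card (set I) * card (set J) * card (set K) \<le> card (set L) + card (set I) ^ 2"
    using L0(2) by (simp add: L P_def card_pairs power2_eq_square mult_ac)
  ultimately show ?thesis by (rule that[rotated])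
qed

text \<open>Surplus directions in L are discarded, as a shorter inner product is a pullback of a
  longer one. The extra summand thus has a prescribed length n for every tensor, which the later
  rotations rely on.\<close>

lemma square_plus_le_MM:
  fixes T :: "idx \<Rightarrow> idx \<Rightarrow> idx \<Rightarrow> 'a::field"
  assumes "card (set I) = d" "card (set J) = d" "card (set K) = d" "n + d ^ 2 \<le> d ^ 3"
  shows "tens.asymp_le (abs_tens (I, J, K, T) ^ 2 + MM 1 n 1) (MM d (d ^ 2) d + MM 1 (d ^ 2) 1)"
proof -
  obtain L where L: "card (set I) * card (set J) * card (set K) \<le> card (set L) + card (set I) ^ 2"
    and deg: "degenerates 2
      (raw_plus (raw_times (I, J, K, T) (I, J, K, T)) (raw_matmul [Leaf 0] L [Leaf 0]))
      (raw_plus (raw_matmul K (pairs I J) K) (raw_matmul [Leaf 0] (pairs J J) [Leaf 0]))"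
    by (rule degenerates_square)
  have "n \<le> card (set L)" using L assms by (simp add: power3_eq_cube)
  then obtain L' where L': "L' \<subseteq> set L" "card L' = n" by (meson obtain_subset_with_card_n)
  obtain L1 where L1: "set L1 = L'" using finite_list[OF finite_subset[OF L'(1) finite_set]] by blast
  have "pullback (raw_plus (raw_times (I, J, K, T) (I, J, K, T)) (raw_matmul [Leaf 0] L1 [Leaf 0]))
      (raw_plus (raw_times (I, J, K, T) (I, J, K, T)) (raw_matmul [Leaf 0] L [Leaf 0]))"
    by (intro pullback_plus pullback_refl pullback_matmul) (use L' L1 in \<open>auto intro: card_mono\<close>)
  from degenerates_asymp_le[OF degenerates_pullback[OF this]] degenerates_asymp_le[OF deg]
  have "tens.asymp_le (abs_tens (raw_plus (raw_times (I, J, K, T) (I, J, K, T)) (raw_matmul [Leaf 0] L1 [Leaf 0])))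
      (abs_tens (raw_plus (raw_matmul K (pairs I J) K) (raw_matmul [Leaf 0] (pairs J J) [Leaf 0])))"
    by (rule tens.asymp_le_trans)
  then show ?thesis
    by (simp add: assms L1 L' abs_raw_matmul card_pairs power2_eq_square
        flip: plus_tens.abs_eq times_tens.abs_eq)
qed

section \<open>The bound on the asymptotic rank\<close>

lemma F_MM_ge:
  assumes "d > 0"
  shows "real d ^ 2 \<le> tens.F (MM d d d :: 'a::field tens)"
proof (rule LIMSEQ_le_const[OF tens.F_tendsto], intro exI[of _ 1] allI impI)
  fix n :: nat assume "1 \<le> n"
  have "(d ^ n) ^ 2 \<le> trank ((MM d d d :: 'a tens) ^ n)"
    using matmul_rank_ge[of "d ^ n", where 'a = 'a] by (simp add: MM_power trank_MM)
  then have "real ((d ^ n) ^ 2) \<le> real (trank ((MM d d d :: 'a tens) ^ n))" by (simp only: of_nat_le_iff)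
  then have "(real d ^ 2) ^ n \<le> real (trank ((MM d d d :: 'a tens) ^ n))"
    by (simp add: mult.commute flip: power_mult)
  then have "root n ((real d ^ 2) ^ n) \<le> root n (real (trank ((MM d d d :: 'a tens) ^ n)))"
    using \<open>1 \<le> n\<close> by (intro real_root_le_mono) auto
  then show "real d ^ 2 \<le> root n (real (trank ((MM d d d :: 'a tens) ^ n)))"
    using \<open>1 \<le> n\<close> by (simp add: real_root_power_cancel)
qed

lemma F_MM_le:
  assumes "d \<ge> 2" and \<tau>: "(\<lambda>n. real (matmul_rank TYPE('a::field) n n n)) \<in> O(\<lambda>n. real n powr \<tau>)"
  shows "tens.F (MM d d d :: 'a tens) \<le> real d powr \<tau>"
proof -
  obtain c where "c > 0" and "\<forall>\<^sub>F n in sequentially.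
      norm (real (matmul_rank TYPE('a) n n n)) \<le> c * norm (real n powr \<tau>)"
    using landau_o.bigE[OF \<tau>] by blast
  then obtain N where N: "\<And>n. n \<ge> N \<Longrightarrow> real (matmul_rank TYPE('a) n n n) \<le> c * real n powr \<tau>"
    by (auto simp: eventually_sequentially)
  \<comment> \<open>The O-bound holds only for sizes from N on. For the power \<open>Suc N\<close>,
    every size \<open>d ^ (Suc N * k)\<close> with k > 0 is at least N, and k = 0 is covered by
    \<open>max c 1\<close>. The root is taken at the end by \<open>F_power\<close>.\<close>
  have "tens.F ((MM d d d :: 'a tens) ^ Suc N) \<le> (real d powr \<tau>) ^ Suc N"
  proof (rule tens.F_leI)
    fix k
    show "real (trank (((MM d d d :: 'a tens) ^ Suc N) ^ k)) \<le> max c 1 * real (k + 1) ^ 0 * ((real d powr \<tau>) ^ Suc N) ^ k"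
    proof (cases "k = 0")
      case True
      then show ?thesis by (simp add: tens.R_1)
    next
      case False
      let ?n = "d ^ (Suc N * k)"
      have "N \<le> Suc N * k" using False by (cases k) auto
      also have "\<dots> \<le> 2 ^ (Suc N * k)" by (rule less_imp_le[OF less_exp])
      also have "\<dots> \<le> ?n" using assms(1) by (intro power_mono) auto
      finally have "real (matmul_rank TYPE('a) ?n ?n ?n) \<le> c * real ?n powr \<tau>" by (rule N)
      also have "\<dots> \<le> max c 1 * real ?n powr \<tau>" by (intro mult_right_mono) auto
      also have "real ?n powr \<tau> = ((real d powr \<tau>) ^ Suc N) ^ k"
        using assms(1) by (simp add: powr_realpow[symmetric] powr_powr mult_ac distrib_left flip: power_mult del: power_Suc)
      finally show ?thesis by (simp add: MM_power trank_MM power_mult[symmetric] del: power_Suc mult_Suc)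
    qed
  qed simp
  then have "tens.F (MM d d d :: 'a tens) ^ Suc N \<le> (real d powr \<tau>) ^ Suc N"
    by (simp only: tens.F_power)
  then show ?thesis by (rule power_le_imp_le_base) simp
qed

text \<open>The infimum need not be attained. Taking logarithms to base d makes the asymptotic rank
  of \<open>MM d d d\<close> a lower bound for all admissible exponents, and such bounds pass to the
  infimum. The case d = 2 already yields the lower bound 2.\<close>

lemma matmul_exponent_ge_2: "2 \<le> matmul_exponent TYPE('a::field)"
  and F_MM_le_exponent: "d \<ge> 2 \<Longrightarrow> tens.F (MM d d d :: 'a tens) \<le> real d powr matmul_exponent TYPE('a)"
proof -
  let ?S = "{\<tau>. (\<lambda>n. real (matmul_rank TYPE('a) n n n)) \<in> O(\<lambda>n. real n powr \<tau>)}"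
  have "(\<lambda>n. real (matmul_rank TYPE('a) n n n)) \<in> O(\<lambda>n. real n powr 6)"
  proof (rule landau_o.bigI[of 1])
    show "\<forall>\<^sub>F n in sequentially. norm (real (matmul_rank TYPE('a) n n n)) \<le> 1 * norm (real n powr 6)"
      using eventually_gt_at_top[of 0]
    proof eventually_elim
      case (elim n)
      have "real (matmul_rank TYPE('a) n n n) \<le> real (n ^ 6)" using matmul_rank_le by (simp only: of_nat_le_iff)
      then show ?case using elim by simp
    qed
  qed simp
  then have ne: "?S \<noteq> {}" by blast
  have log_le: "log (real d) (tens.F (MM d d d :: 'a tens)) \<le> matmul_exponent TYPE('a)" if "d \<ge> 2" for d
    unfolding matmul_exponent_def
  proof (rule cInf_greatest[OF ne])
    fix \<tau> assume "\<tau> \<in> ?S"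
    then have "tens.F (MM d d d :: 'a tens) \<le> real d powr \<tau>" using F_MM_le[OF that] by blast
    moreover have "0 < tens.F (MM d d d :: 'a tens)"
      using F_MM_ge[of d, where 'a = 'a] that by (smt (verit) of_nat_0_less_iff zero_less_power less_le_trans pos2)
    ultimately show "log (real d) (tens.F (MM d d d :: 'a tens)) \<le> \<tau>"
      using that by (simp add: log_le_iff)
  qed
  have pos: "0 < tens.F (MM d d d :: 'a tens)" if "d \<ge> 2" for d
    using F_MM_ge[of d, where 'a = 'a] that by (smt (verit) of_nat_0_less_iff zero_less_power less_le_trans pos2)
  show "tens.F (MM d d d :: 'a tens) \<le> real d powr matmul_exponent TYPE('a)" if "d \<ge> 2"
    using log_le[OF that] pos[OF that] that by (simp add: log_le_iff)
  have "2 = log (real 2) (real 2 ^ 2)" 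
    using log_nat_power[where b = 2 and x = "2 :: real" and n = 2] by simp
  also have "\<dots> \<le> log (real 2) (tens.F (MM 2 2 2 :: 'a tens))"
    using F_MM_ge[of 2, where 'a = 'a] pos[of 2] by simp
  also have "\<dots> \<le> matmul_exponent TYPE('a)" by (rule log_le) simp
  finally show "2 \<le> matmul_exponent TYPE('a)" .
qed

section \<open>Exponents of a seminorm along one direction\<close>

lemma power_seminorm_log_bound:
  fixes h :: "nat \<Rightarrow> 'a::field tens"
  assumes G: "tens.power_seminorm G"
    and pow: "\<And>m k. h m ^ k = h (m ^ k)"
    and mono: "\<And>m n. m \<le> n \<Longrightarrow> tens.asymp_le (h m) (h n)"
    and one: "\<And>m. m > 0 \<Longrightarrow> tens.asymp_le 1 (h m)"
    and d: "d \<ge> 2" and n: "n > 0"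
  obtains b where "b \<ge> 0" "G (h d) = real d powr b" "real n powr b \<le> G (h n)"
proof -
  have nn: "0 \<le> G x" and G1: "G 1 = 1" and Gpow: "G (x ^ k) = G x ^ k"
    and Gmono: "tens.asymp_le x y \<Longrightarrow> G x \<le> G y" for x y k
    using G unfolding tens.power_seminorm_def by blast+
  have ge1: "1 \<le> G (h d)" using Gmono[OF one[of d]] G1 d by simp
  \<comment> \<open>The value at d fixes the exponent of \<open>G\<close> along the family h. At
    other arguments the exponent is recovered by comparing powers of d with powers of n.\<close>
  define b where "b = log (real d) (G (h d))"
  have b: "G (h d) = real d powr b" "b \<ge> 0"
    using ge1 d by (auto simp: b_def)
  have "real n powr b \<le> G (h n)"
  proof (rule le_of_power_le)
    fix k :: nat
    define s where "s = log (real d) (real n)"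
    have ns: "real n = real d powr s" using d n by (simp add: s_def)
    have s0: "s \<ge> 0" using d n by (simp add: s_def)
    \<comment> \<open>\<open>d ^ j\<close> is the largest power of d below \<open>n ^ k\<close>, up
      to equality. Rounding down costs at most one factor d^b, independent of k and hence
      harmless.\<close>
    define j where "j = nat \<lfloor>real k * s\<rfloor>"
    have j: "real j \<le> real k * s" "real k * s \<le> real j + 1"
    proof -
      have "real k * s \<ge> 0" using s0 by simp
      then show "real j \<le> real k * s" "real k * s \<le> real j + 1" unfolding j_def by linarith+
    qed
    have "real d powr real j \<le> real d powr (real k * s)" using j d by (intro powr_mono) auto
    also have "\<dots> = real n ^ k"
      using d n by (simp add: ns powr_powr mult.commute flip: powr_realpow)
    finally have "real (d ^ j) \<le> real (n ^ k)" using d by (simp add: powr_realpow)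
    then have "d ^ j \<le> n ^ k" by (simp only: of_nat_le_iff)
    from Gmono[OF mono[OF this]] have le: "G (h d) ^ j \<le> G (h n) ^ k"
      by (simp add: Gpow flip: pow)
    have "(real n powr b) ^ k = real d powr (b * (real k * s))"
      using d n by (simp add: ns powr_powr mult_ac flip: powr_realpow)
    also have "\<dots> \<le> real d powr (b * (real j + 1))"
      using j b d by (intro powr_mono mult_left_mono) auto
    also have "\<dots> = real d powr b * G (h d) ^ j"
      using d by (simp add: b(1) powr_powr powr_add distrib_left mult_ac flip: powr_realpow)
    also have "\<dots> \<le> real d powr b * G (h n) ^ k" by (intro mult_left_mono le) auto
    finally show "(real n powr b) ^ k \<le> real d powr b * real (k + 1) ^ 0 * G (h n) ^ k" by simp
  qed (use nn in auto)
  with b show ?thesis by (intro that)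
qed

text \<open>The left side is shown to increase up to b = \<omega>/3. With y = d^x, n <= d^3 gives
  n^x <= y^3 and ln n <= 3 ln d, and the derivative is nonnegative once 3 y^2 <= d^\<omega> + 2 y.
  For y >= 2 this follows from y (y - 1) (y - 2) >= 0 and y^3 <= d^\<omega>, that is, from x <=
  \<omega>/3. For y < 2 the left side is at most 8 + 2 y, and d^\<omega> >= 9 by d >= 3 and \<omega>
  >= 2.\<close>

lemma exponent_bound_mono:
  fixes \<omega> b d n :: real
  assumes d: "d \<ge> 3" and n: "0 < n" "n \<le> d ^ 3" and "\<omega> \<ge> 2" and b: "0 \<le> b" "b \<le> \<omega> / 3"
  shows "d powr (\<omega> + b) + d powr (2 * b) - n powr b
    \<le> d powr (4 / 3 * \<omega>) + d powr (2 / 3 * \<omega>) - n powr (\<omega> / 3)"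
proof -
  let ?f = "\<lambda>b. d powr (\<omega> + b) + d powr (2 * b) - n powr b"
  have "?f b \<le> ?f (\<omega> / 3)"
  proof (rule DERIV_nonneg_imp_nondecreasing[OF b(2)])
    fix x assume x: "b \<le> x" "x \<le> \<omega> / 3"
    define y where "y = d powr x"
    have "1 \<le> y" using d x b by (simp add: y_def ge_one_powr_ge_zero)
    have y3: "d powr (3 * x) = y ^ 3" "d powr (2 * x) = y ^ 2"
      using d by (simp_all add: y_def powr_powr mult.commute flip: powr_realpow)
    have D: "y ^ 3 \<le> d powr \<omega>" "9 \<le> d powr \<omega>"
    proof -
      show "y ^ 3 \<le> d powr \<omega>" unfolding y3(1)[symmetric] using d x by (intro powr_mono) auto
      have "(9::real) = 3 ^ 2" by simp
      also have "\<dots> \<le> d ^ 2" using d by (intro power_mono) auto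
      also have "\<dots> = d powr 2" using d by simp
      also have "\<dots> \<le> d powr \<omega>" using d \<open>\<omega> \<ge> 2\<close> by (intro powr_mono) auto
      finally show "9 \<le> d powr \<omega>" .
    qed
    have "3 * y ^ 2 \<le> d powr \<omega> + 2 * y"
    proof (cases "y \<ge> 2")
      case True
      have "0 \<le> y * (y - 1) * (y - 2)" using True by simp
      then have "3 * y ^ 2 \<le> y ^ 3 + 2 * y" by (simp add: algebra_simps power2_eq_square power3_eq_cube)
      then show ?thesis using D by simp
    next
      case False
      have "0 \<le> (2 - y) * (3 * y + 4)" using False \<open>1 \<le> y\<close> by simp
      then have "3 * y ^ 2 \<le> 8 + 2 * y" by (simp add: algebra_simps power2_eq_square)
      then show ?thesis using D by simp
    qed
    then have "y * (3 * y ^ 2) \<le> y * (d powr \<omega> + 2 * y)" using \<open>1 \<le> y\<close> by (intro mult_left_mono) auto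
    then have key: "3 * y ^ 3 \<le> d powr (\<omega> + x) + 2 * d powr (2 * x)"
      unfolding y3 by (simp add: powr_add y_def[symmetric] algebra_simps power2_eq_square power3_eq_cube)
    have "n powr x * ln n \<le> d powr (3 * x) * (3 * ln d)"
    proof (cases "n \<ge> 1")
      case True
      have "n powr x \<le> (d ^ 3) powr x" using n x b by (intro powr_mono2) auto
      also have "\<dots> = (d powr 3) powr x" using d by simp
      also have "\<dots> = d powr (3 * x)" by (simp only: powr_powr)
      finally have 1: "n powr x \<le> d powr (3 * x)" .
      have "ln n \<le> ln (d ^ 3)" using n d by simp
      also have "\<dots> = 3 * ln d" using d by (simp add: ln_realpow)
      finally show ?thesis using 1 True by (intro mult_mono) auto
    next
      case False
      then have "n powr x * ln n \<le> 0" using n by (intro mult_nonneg_nonpos) auto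
      also have "0 \<le> d powr (3 * x) * (3 * ln d)" using d by simp
      finally show ?thesis .
    qed
    also have "\<dots> = 3 * y ^ 3 * ln d" by (simp add: y3)
    also have "\<dots> \<le> (d powr (\<omega> + x) + 2 * d powr (2 * x)) * ln d"
      using key d by (intro mult_right_mono) auto
    finally have nonneg: "0 \<le> d powr (\<omega> + x) * ln d + 2 * (d powr (2 * x) * ln d) - n powr x * ln n"
      by (simp add: algebra_simps)
    have "(?f has_real_derivative d powr (\<omega> + x) * ln d + 2 * (d powr (2 * x) * ln d) - n powr x * ln n) (at x)"
      using d n by (auto intro!: derivative_eq_intros)
    with nonneg show "\<exists>y. (?f has_real_derivative y) (at x) \<and> 0 \<le> y" by blast
  qed
  also have "?f (\<omega> / 3) = d powr (4 / 3 * \<omega>) + d powr (2 / 3 * \<omega>) - n powr (\<omega> / 3)"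
    by (simp add: field_simps)
  finally show ?thesis .
qed

text \<open>The family h stands for whichever direction has exponent at most \<omega>/3.
  Superadditivity bounds the left side of the asymptotic inequality from below, subadditivity and
  submultiplicativity bound the right side from above, and \<open>G (h n)\<close> can then be
  subtracted.\<close>

lemma power_seminorm_square_le:
  fixes h :: "nat \<Rightarrow> 'a::field tens"
  assumes G: "tens.power_seminorm G" and t: "tens.multiplicative_at G t" "tens.asymp_le 1 t"
    and pow: "\<And>m k. h m ^ k = h (m ^ k)"
    and one: "\<And>m. m > 0 \<Longrightarrow> tens.asymp_le 1 (h m)"
    and le: "tens.asymp_le (t ^ 2 + h n) (MM d d d * h d + h (d ^ 2))"
    and GM: "G (MM d d d) \<le> real d powr \<omega>" and "\<omega> \<ge> 2" and d: "d \<ge> 3"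
    and n: "n > 0" "n \<le> d ^ 3"
    and b: "G (h d) = real d powr b" "0 \<le> b" "b \<le> \<omega> / 3" "real n powr b \<le> G (h n)"
  shows "G t ^ 2 \<le> real d powr (4 / 3 * \<omega>) + real d powr (2 / 3 * \<omega>) - real n powr (\<omega> / 3)"
proof -
  have nn: "0 \<le> G x" and Gmult: "G (x * y) \<le> G x * G y" and Gpow: "G (x ^ k) = G x ^ k"
    and Gadd: "G (x + y) \<le> G x + G y" and Gmono: "tens.asymp_le x y \<Longrightarrow> G x \<le> G y" for x y k
    using G unfolding tens.power_seminorm_def by blast+
  have "tens.multiplicative_at G (t ^ 2)"
    using t(1) by (simp add: tens.multiplicative_at_def power2_eq_square mult.assoc)
  then have "G (t ^ 2) + G (h n) \<le> G (t ^ 2 + h n)"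
    by (intro tens.power_seminorm_superadditive G tens.asymp_le_one_power t one n)
  also have "\<dots> \<le> G (MM d d d * h d + h (d ^ 2))" by (rule Gmono[OF le])
  also have "\<dots> \<le> G (MM d d d * h d) + G (h (d ^ 2))" by (rule Gadd)
  also have "G (MM d d d * h d) \<le> G (MM d d d) * G (h d)" by (rule Gmult)
  also have "\<dots> \<le> real d powr \<omega> * real d powr b" using GM nn unfolding b(1) by (intro mult_right_mono) auto
  also have "\<dots> = real d powr (\<omega> + b)" by (simp add: powr_add)
  also have "G (h (d ^ 2)) = real d powr (2 * b)"
    using d by (simp add: Gpow b(1) powr_powr mult.commute flip: pow powr_realpow)
  finally have "G t ^ 2 \<le> real d powr (\<omega> + b) + real d powr (2 * b) - real n powr b"
    using b(4) by (simp add: Gpow)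
  also have "\<dots> \<le> real d powr (4 / 3 * \<omega>) + real d powr (2 / 3 * \<omega>) - real n powr (\<omega> / 3)"
  proof (rule exponent_bound_mono)
    show "real n \<le> real d ^ 3" using n(2) by (simp flip: of_nat_power)
  qed (use assms in auto)
  finally show ?thesis .
qed

lemma F_tensor_square_le:
  fixes T :: "(nat, nat, nat, 'a::field) tensor"
  assumes d: "d \<ge> 3" and nz: "i0 < d" "j0 < d" "k0 < d" "T i0 j0 k0 \<noteq> 0"
  defines "\<omega> \<equiv> matmul_exponent TYPE('a)" and "n \<equiv> d ^ 3 - d ^ 2"
  shows "tens.F (abs_tens (raw_tensor d T)) ^ 2
    \<le> real d powr (4 / 3 * \<omega>) + real d powr (2 / 3 * \<omega>) - real n powr (\<omega> / 3)"
proof -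
  define t where "t = abs_tens (raw_tensor d T)"
  have n: "n > 0" "n \<le> d ^ 3" "n + d ^ 2 \<le> d ^ 3"
  proof -
    have "d ^ 2 < d ^ 3" using d by (intro power_strict_increasing) auto
    then show "n > 0" "n \<le> d ^ 3" "n + d ^ 2 \<le> d ^ 3" by (auto simp: n_def)
  qed
  have "degenerates 0 ([Leaf 0], [Leaf 0], [Leaf 0], \<lambda>_ _ _. 1) (raw_tensor d T)"
    unfolding raw_tensor_def
    by (rule degenerates_nonzero[of "Leaf i0" _ "Leaf j0" _ "Leaf k0"]) (auto simp: in_leaves_iff nz)
  then have one_t: "tens.asymp_le 1 t"
    unfolding t_def one_tens.abs_eq by (rule degenerates_asymp_le)
  have oneX: "tens.asymp_le 1 (MM d 1 1 :: 'a tens)" and oneY: "tens.asymp_le 1 (MM 1 d 1 :: 'a tens)"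
    using d by (auto intro: one_le_MM)
  \<comment> \<open>The tensor t has to come first: smoothing at another element could lower the
    value at t, whereas after this step multiplicativity at t protects the value
    \<open>F t\<close>.\<close>
  obtain G1 where G1: "tens.power_seminorm G1" "\<And>x. G1 x \<le> tens.F x" "G1 t = tens.F t" "tens.multiplicative_at G1 t"
    by (rule tens.smoothing[OF tens.power_seminorm_F one_t]) (rule that)
  obtain G2 where G2: "tens.power_seminorm G2" "\<And>x. G2 x \<le> G1 x" "tens.multiplicative_at G2 (MM d 1 1)"
    "G2 t = G1 t" "tens.multiplicative_at G2 t"
    by (rule tens.smoothing[OF G1(1) oneX])
      (rule that, assumption, assumption, assumption, use G1(4) in blast, use G1(4) in blast)
  obtain G where G: "tens.power_seminorm G" "\<And>x. G x \<le> G2 x" "tens.multiplicative_at G (MM 1 d 1)"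
    "G t = G2 t" "tens.multiplicative_at G t" "tens.multiplicative_at G (MM d 1 1)"
    by (rule tens.smoothing[OF G2(1) oneY])
      (rule that, assumption, assumption, assumption, use G2(5) in blast, use G2(5) in blast, use G2(3) in blast)
  have Gt: "G t = tens.F t" using G1(3) G2(4) G(4) by simp
  have "G (MM d d d) \<le> tens.F (MM d d d :: 'a tens)" by (rule order_trans[OF G(2) order_trans[OF G2(2) G1(2)]])
  also have "\<dots> \<le> real d powr \<omega>" unfolding \<omega>_def using d by (intro F_MM_le_exponent) simp
  finally have GM: "G (MM d d d) \<le> real d powr \<omega>" .
  have "\<omega> \<ge> 2" unfolding \<omega>_def by (rule matmul_exponent_ge_2)
  have d2: "d \<ge> 2" using d by simp
  obtain b1 where b1: "b1 \<ge> 0" "G (MM d 1 1) = real d powr b1" "real n powr b1 \<le> G (MM n 1 1)"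
    by (rule power_seminorm_log_bound[OF G(1), of "\<lambda>m. MM m 1 1" d n])
      (auto simp: MM_power d2 n(1) intro!: MM_mono one_le_MM)
  obtain b2 where b2: "b2 \<ge> 0" "G (MM 1 d 1) = real d powr b2" "real n powr b2 \<le> G (MM 1 n 1)"
    by (rule power_seminorm_log_bound[OF G(1), of "\<lambda>m. MM 1 m 1" d n])
      (auto simp: MM_power d2 n(1) intro!: MM_mono one_le_MM)
  obtain b3 where b3: "b3 \<ge> 0" "G (MM 1 1 d) = real d powr b3" "real n powr b3 \<le> G (MM 1 1 n)"
    by (rule power_seminorm_log_bound[OF G(1), of "\<lambda>m. MM 1 1 m" d n])
      (auto simp: MM_power d2 n(1) intro!: MM_mono one_le_MM)
  \<comment> \<open>Multiplicativity at \<open>MM d 1 1\<close> and at \<open>MM 1 d 1\<close>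
    splits off two factors and leaves the third direction as the remaining one.\<close>
  have "real d powr (b1 + b2 + b3) = G (MM d 1 1) * (G (MM 1 d 1) * G (MM 1 1 d))"
    by (simp only: b1(2) b2(2) b3(2) powr_add mult.assoc)
  also have "\<dots> = G (MM d 1 1 * (MM 1 d 1 * MM 1 1 d))"
    using G(3,6) by (simp only: tens.multiplicative_at_def)
  also have "\<dots> \<le> real d powr \<omega>" using GM by (simp add: MM_mult)
  finally have "b1 + b2 + b3 \<le> \<omega>" using d by simp
  then consider "b1 \<le> \<omega> / 3" | "b2 \<le> \<omega> / 3" | "b3 \<le> \<omega> / 3" by linarith
  moreover have le2: "tens.asymp_le (x ^ 2 + MM 1 n 1) (MM d (d ^ 2) d + MM 1 (d ^ 2) 1)"
    if "x = abs_tens (leaves d, leaves d, leaves d, S)" for x :: "'a tens" and S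
    unfolding that by (rule square_plus_le_MM) (simp_all add: card_leaves n)
  define t1 where "t1 = rotate t"
  define t2 where "t2 = rotate t1"
  have t: "t = rotate t2" by (simp add: t1_def t2_def rotate_rotate_rotate)
  have shape: "\<exists>S. x = abs_tens (leaves d, leaves d, leaves d, S)" if "x \<in> {t, t1, t2}" for x
    using that by (auto simp: t_def t1_def t2_def raw_tensor_def rotate_abs)
  have sq: "d ^ 2 = d * d" by (simp add: power2_eq_square)
  have rot: "tens.asymp_le (rotate x ^ 2 + rotate y) (rotate z + rotate w)"
    if "tens.asymp_le (x ^ 2 + y) (z + w)" for x y z w :: "'a tens"
    using asymp_le_rotate[OF that] by (simp add: rotate_plus rotate_power)
  \<comment> \<open>One rotation turns t2 into t and moves the inner product from the middle to the
    first direction. The third direction needs two rotations and hence starts from t1.\<close>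
  have ineq1: "tens.asymp_le (t ^ 2 + MM n 1 1) (MM d d d * MM d 1 1 + MM (d ^ 2) 1 1)"
  proof -
    obtain S where "t2 = abs_tens (leaves d, leaves d, leaves d, S)" using shape[of t2] by blast
    from rot[OF le2[OF this]] show ?thesis by (simp add: rotate_MM MM_mult sq flip: t)
  qed
  have ineq2: "tens.asymp_le (t ^ 2 + MM 1 n 1) (MM d d d * MM 1 d 1 + MM 1 (d ^ 2) 1)"
  proof -
    obtain S where "t = abs_tens (leaves d, leaves d, leaves d, S)" using shape[of t] by blast
    from le2[OF this] show ?thesis by (simp add: MM_mult sq)
  qed
  have ineq3: "tens.asymp_le (t ^ 2 + MM 1 1 n) (MM d d d * MM 1 1 d + MM 1 1 (d ^ 2))"
  proof -
    obtain S where "t1 = abs_tens (leaves d, leaves d, leaves d, S)" using shape[of t1] by blast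
    from rot[OF rot[OF le2[OF this]]] show ?thesis
      by (simp add: rotate_MM MM_mult sq flip: t t2_def)
  qed
  ultimately have "G t ^ 2 \<le> real d powr (4 / 3 * \<omega>) + real d powr (2 / 3 * \<omega>) - real n powr (\<omega> / 3)"
  proof cases
    case 1
    show ?thesis
      by (rule power_seminorm_square_le[OF G(1,5) one_t _ _ ineq1 GM \<open>\<omega> \<ge> 2\<close> d n(1,2) b1(2,1) 1 b1(3)])
        (auto simp: MM_power intro!: one_le_MM)
  next
    case 2
    show ?thesis
      by (rule power_seminorm_square_le[OF G(1,5) one_t _ _ ineq2 GM \<open>\<omega> \<ge> 2\<close> d n(1,2) b2(2,1) 2 b2(3)])
        (auto simp: MM_power intro!: one_le_MM)
  next
    case 3
    show ?thesis
      by (rule power_seminorm_square_le[OF G(1,5) one_t _ _ ineq3 GM \<open>\<omega> \<ge> 2\<close> d n(1,2) b3(2,1) 3 b3(3)])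
        (auto simp: MM_power intro!: one_le_MM)
  qed
  then show ?thesis unfolding Gt unfolding t_def .
qed

theorem theorem7p6:
  fixes d :: nat and T :: "(nat, nat, nat, 'a::field) tensor" and \<omega> :: real
  defines "\<omega> \<equiv> matmul_exponent TYPE('a)"
  assumes "d \<ge> 3"
  shows "asymptotic_rank {..<d} {..<d} {..<d} T
           \<le> sqrt (real d powr (4/3 * \<omega>) + real d powr (2/3 * \<omega>) - (real d ^ 3 - real d ^ 2) powr (\<omega> / 3))
       \<and> sqrt (real d powr (4/3 * \<omega>) + real d powr (2/3 * \<omega>) - (real d ^ 3 - real d ^ 2) powr (\<omega> / 3))
           < real d powr (2/3 * \<omega>)"
proof
  let ?B = "real d powr (4/3 * \<omega>) + real d powr (2/3 * \<omega>) - (real d ^ 3 - real d ^ 2) powr (\<omega> / 3)"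
  have d: "real d \<ge> 3" using assms(2) by simp
  have \<omega>: "\<omega> \<ge> 2" unfolding \<omega>_def by (rule matmul_exponent_ge_2)
  have n: "real (d ^ 3 - d ^ 2) = real d ^ 3 - real d ^ 2"
    using assms(2) by (simp add: of_nat_diff power_increasing)
  \<comment> \<open>Here d > 2 makes d^3 - d^2 larger than d^2, so the subtracted term outweighs
    d^(2/3 \<omega>).\<close>
  have "real d ^ 2 * 2 < real d ^ 2 * real d" using d by (intro mult_strict_left_mono) auto
  then have lt: "real d ^ 2 < real d ^ 3 - real d ^ 2" by (simp add: power2_eq_square power3_eq_cube)
  then have n0: "0 \<le> real d ^ 3 - real d ^ 2" using zero_le_power2[of "real d"] by linarith
  show "asymptotic_rank {..<d} {..<d} {..<d} T \<le> sqrt ?B"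
  \<comment> \<open>For the zero tensor 1 is not below T, so the seminorm argument does not apply.
    Its asymptotic rank is at most 0, and it remains to see that the radicand is
    nonnegative.\<close>
  proof (cases "\<forall>i<d. \<forall>j<d. \<forall>k<d. T i j k = 0")
    case True
    have "tensor_rank (set (leaves d)) (set (leaves d)) (set (leaves d))
        (\<lambda>i j k. T (unleaf i) (unleaf j) (unleaf k)) \<le> card ({} :: nat set)"
      by (rule tensor_rank_leI) (use True in \<open>auto simp: in_leaves_iff\<close>)
    then have "trank (abs_tens (raw_tensor d T)) = 0" by (simp add: raw_tensor_def trank_abs)
    then have "asymptotic_rank {..<d} {..<d} {..<d} T \<le> 0"
      using tens.F_le_R[of "abs_tens (raw_tensor d T)"] by (simp add: asymptotic_rank_eq)
    also have "0 \<le> sqrt ?B"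
    proof -
      have "(real d ^ 3 - real d ^ 2) powr (\<omega> / 3) \<le> (real d ^ 3) powr (\<omega> / 3)"
        using n0 \<omega> by (intro powr_mono2) auto
      also have "\<dots> = (real d powr 3) powr (\<omega> / 3)" using d by simp
      also have "\<dots> = real d powr \<omega>" by (simp add: powr_powr del: powr_numeral)
      also have "\<dots> \<le> real d powr (4/3 * \<omega>)" using d \<omega> by (intro powr_mono) auto
      finally show ?thesis by (simp add: add_increasing2)
    qed
    finally show ?thesis .
  next
    case False
    then obtain i0 j0 k0 where nz: "i0 < d" "j0 < d" "k0 < d" "T i0 j0 k0 \<noteq> 0" by blast
    from F_tensor_square_le[OF assms(2), of i0 j0 k0 T, OF nz]
    show ?thesis unfolding asymptotic_rank_eq \<omega>_def n by (rule real_le_rsqrt)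
  qed
  have "real d powr (2/3 * \<omega>) = (real d powr 2) powr (\<omega> / 3)"
    by (simp add: powr_powr del: powr_numeral)
  also have "\<dots> = (real d ^ 2) powr (\<omega> / 3)" using d by simp
  also have "\<dots> < (real d ^ 3 - real d ^ 2) powr (\<omega> / 3)"
    using lt \<omega> by (intro powr_less_mono2) auto
  finally have "?B < real d powr (4/3 * \<omega>)" by simp
  also have "\<dots> = (real d powr (2/3 * \<omega>)) ^ 2"
    by (simp add: power2_eq_square flip: powr_add)
  finally have "sqrt ?B < sqrt ((real d powr (2/3 * \<omega>)) ^ 2)" by (rule real_sqrt_less_mono)
  then show "sqrt ?B < real d powr (2/3 * \<omega>)" by simp
qed

end
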